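(* Let $G$ be a strongly balanced connected graph with $v(G)=k\ge2$ vertices and $e(G)$ edges, and let $N_G$ be the number of copies of $G$ in the binomial random-connection model $G_H(\mathcal{X}_n)$ with connection probabilities $p_nH(X_i,X_j)$. Suppose that $$\mathrm{Var}\Big[\sum_{\ell=1}^k f_{(\ell)}(X_1)\Big]>0 .$$ Then there is a constant $C>0$, independent of $n\ge1$ and $j$, such that for $n$ large enough the cumulants of the normalized subgraph count $$\overline{N}_G:=\frac{N_G-\kappa_1(N_G)}{\sqrt{\kappa_2(N_G)}}$$ satisfy, for all $j\ge3$, $$\kappa_j(\overline{N}_G)\le\begin{cases}\dfrac{(j!)^{1+v(G)}}{(Cn)^{j/2-1}} & \text{when } n^{-(v(G)-1)/e(G)}\ll p_n,\\[3mm] \dfrac{(j!)^{1+v(G)}}{\big(C\,n^{v(G)}p_n^{e(G)}\big)^{j/2-1}} & \text{when } p_n\ll n^{-(v(G)-1)/e(G)}.\end{cases}$$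
   Context: Binomial random-connection model. $X_1,\dots,X_n$ are i.i.d. random points of $\mathbb{R}^d$ with common continuous (atomless) distribution $\mu$, $\mathcal{X}_n=\{X_1,\dots,X_n\}$, $H:\mathbb{R}^d\times\mathbb{R}^d\to[0,1]$ is a symmetric measurable function, and $p_n\in(0,1)$ for each $n$; $\mu$ and $H$ do not depend on $n$. Given $\mathcal{X}_n$, each pair $X_i,X_j$ ($i\ne j$) is connected by an edge (written $X_i\sim X_j$) independently with probability $p_nH(X_i,X_j)$. The resulting random graph is $G_H(\mathcal{X}_n)$. Subgraph count. $G=(V_G,E_G)$ is a simple graph with $v(G)=|V_G|=k$, vertex set identified with $[k]=\{1,\dots,k\}$, $e(G)=|E_G|$, and $a(G)$ is the number of automorphisms of $G$. With $[n]^k_{\neq}:=\{\beta\in[n]^k:\beta(i)\ne\beta(j)\text{ for }i\ne j\}$, $$N_G:=\frac{1}{a(G)}\sum_{\beta\in[n]^k_{\neq}}\ \prod_{\{u,v\}\in E_G}\mathbf{1}_{\{X_{\beta(u)}\sim X_{\beta(v)}\}}.$$ For $1\le\ell\le k$, $$f_{(\ell)}(x):=\frac{p_n^{e(G)}}{a(G)}\int_{(\mathbb{R}^d)^{k-1}}\prod_{\{u,v\}\in E_G}H(x_u,x_v)\,\mu^{\otimes(k-1)}(\mathrm{d}x_1,\dots,\mathrm{d}x_{\ell-1},\mathrm{d}x_{\ell+1},\dots,\mathrm{d}x_k),\qquad x_\ell:=x.$$ Since $p_n\in(0,1)$, the variance condition does not depend on $n$. $G$ is strongly balanced if $\dfrac{e(G')}{v(G')-1}\le\dfrac{e(G)}{v(G)-1}$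 for every subgraph $G'\subset G$ with $v(G')\ge2$. $f(n)\ll g(n)$ means $f(n)\ge0$, $g(n)>0$ and $\lim_{n\to\infty}f(n)/g(n)=0$. $\kappa_j$ denotes the $j$-th cumulant ($\kappa_1$ mean, $\kappa_2$ variance). *)

theory Defs
  imports "HOL-Probability.Probability" "HOL-Combinatorics.Permutations"
begin

section \<open>Finite simple graphs\<close>

text \<open>A graph is a vertex set together with a set of two-element vertex sets.\<close>

definition simple_graph :: "'v set \<Rightarrow> 'v set set \<Rightarrow> bool" where
  "simple_graph V E \<longleftrightarrow> finite V \<and> (\<forall>e\<in>E. e \<subseteq> V \<and> card e = 2)"

definition graph_connected :: "'v set \<Rightarrow> 'v set set \<Rightarrow> bool" where
  "graph_connected V E \<longleftrightarrow> V \<noteq> {} \<and> (\<forall>u\<in>V. \<forall>v\<in>V. (u, v) \<in> {(x, y). {x, y} \<in> E}\<^sup>*)"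

definition strongly_balanced :: "'v set \<Rightarrow> 'v set set \<Rightarrow> bool" where
  "strongly_balanced V E \<longleftrightarrow>
     (\<forall>V' E'. V' \<subseteq> V \<and> E' \<subseteq> E \<and> simple_graph V' E' \<and> card V' \<ge> 2 \<longrightarrow>
        real (card E') / (real (card V') - 1) \<le> real (card E) / (real (card V) - 1))"

definition num_automorphisms :: "'v set \<Rightarrow> 'v set set \<Rightarrow> nat" where
  "num_automorphisms V E = card {\<pi>. \<pi> permutes V \<and> (\<lambda>e. \<pi> ` e) ` E = E}"

definition vertex_pairs :: "nat \<Rightarrow> nat set set" where
  "vertex_pairs n = {e. e \<subseteq> {1..n} \<and> card e = 2}"

section \<open>The binomial random-connection model\<close>

text \<open>\<open>edge_weight H x {u, v}\<close> is $H(x_u, x_v)$. Ordering the endpoints by \<open>Min\<close> and \<open>Max\<close>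
  is immaterial because \<open>H\<close> is symmetric wherever this is used.\<close>

definition edge_weight :: "('a \<Rightarrow> 'a \<Rightarrow> real) \<Rightarrow> (nat \<Rightarrow> 'a) \<Rightarrow> nat set \<Rightarrow> real" where
  "edge_weight H x e = H (x (Min e)) (x (Max e))"

text \<open>\<open>R \<omega>\<close> is the random edge set: \<open>X i\<close> and \<open>X j\<close> are connected iff \<open>{i, j} \<in> R \<omega>\<close>.
  The last assumption says that, conditionally on the sigma-algebra generated by
  \<open>X 1, \<dots>, X n\<close>, the events \<open>e \<in> R\<close> are independent with probabilities
  \<open>p * edge_weight H X e\<close>; as for \<open>indep_events\<close>, the product rule is required for
  every finite subfamily, and singletons \<open>T\<close> give the individual probabilities.\<close>

locale binomial_random_connection = prob_space M
  for M :: "'w measure" +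
  fixes \<mu> :: "'a::euclidean_space measure"
    and H :: "'a \<Rightarrow> 'a \<Rightarrow> real"
    and p :: real
    and n :: nat
    and X :: "nat \<Rightarrow> 'w \<Rightarrow> 'a"
    and R :: "'w \<Rightarrow> nat set set"
  assumes indep_points: "indep_vars (\<lambda>_. borel) X {1..n}"
    and distr_points: "\<And>i. i \<in> {1..n} \<Longrightarrow> distr M borel (X i) = \<mu>"
    and edges_subset: "\<And>\<omega>. \<omega> \<in> space M \<Longrightarrow> R \<omega> \<subseteq> vertex_pairs n"
    and edges_measurable: "\<And>e. e \<in> vertex_pairs n \<Longrightarrow> {\<omega> \<in> space M. e \<in> R \<omega>} \<in> sets M"
    and edges_given_points: "\<And>T. T \<subseteq> vertex_pairs n \<Longrightarrow>
      (AE \<omega> in M.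
         real_cond_exp M
           (vimage_algebra (space M) (\<lambda>\<omega>. \<lambda>i\<in>{1..n}. X i \<omega>) (PiM {1..n} (\<lambda>_. borel)))
           (indicator {\<omega> \<in> space M. T \<subseteq> R \<omega>}) \<omega>
         = (\<Prod>e\<in>T. p * edge_weight H (\<lambda>i. X i \<omega>) e))"

text \<open>Number of copies of the graph \<open>({1..k}, E)\<close> in the graph \<open>({1..n}, S)\<close>. The image \<open>\<beta> ` e\<close>
  of an edge \<open>e = {u, v}\<close> is \<open>{\<beta> u, \<beta> v}\<close>.\<close>

definition subgraph_count :: "nat \<Rightarrow> nat set set \<Rightarrow> nat \<Rightarrow> nat set set \<Rightarrow> real" where
  "subgraph_count k E n S =
     1 / real (num_automorphisms {1..k} E) *
     (\<Sum>\<beta> \<in> {\<beta> \<in> {1..k} \<rightarrow>\<^sub>E {1..n}. inj_on \<beta> {1..k}}. \<Prod>e\<in>E. of_bool (\<beta> ` e \<in> S))"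

definition vertex_projection ::
  "nat \<Rightarrow> nat set set \<Rightarrow> 'a measure \<Rightarrow> ('a \<Rightarrow> 'a \<Rightarrow> real) \<Rightarrow> real \<Rightarrow> nat \<Rightarrow> 'a \<Rightarrow> real" where
  "vertex_projection k E \<mu> H p l x =
     p ^ card E / real (num_automorphisms {1..k} E) *
     (\<integral>y. (\<Prod>e\<in>E. edge_weight H (y(l := x)) e) \<partial>PiM ({1..k} - {l}) (\<lambda>_. \<mu>))"

section \<open>Cumulants and asymptotic comparison\<close>

text \<open>The cumulants are the derivatives at 0 of the cumulant generating function. This is meant
  for random variables whose moment generating function is finite near 0, e.g. bounded ones.\<close>

definition cumulant :: "'w measure \<Rightarrow> nat \<Rightarrow> ('w \<Rightarrow> real) \<Rightarrow> real" where
  "cumulant M j Y = (deriv ^^ j) (\<lambda>t. ln (\<integral>\<omega>. exp (t * Y \<omega>) \<partial>M)) 0"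

definition normalized :: "'w measure \<Rightarrow> ('w \<Rightarrow> real) \<Rightarrow> 'w \<Rightarrow> real" where
  "normalized M Y \<omega> = (Y \<omega> - cumulant M 1 Y) / sqrt (cumulant M 2 Y)"

text \<open>Sequences are indexed by \<open>n \<ge> 1\<close>; the value at 0 is irrelevant.\<close>

definition much_less :: "(nat \<Rightarrow> real) \<Rightarrow> (nat \<Rightarrow> real) \<Rightarrow> bool" where
  "much_less f g \<longleftrightarrow> (\<forall>n\<ge>1. f n \<ge> 0 \<and> g n > 0) \<and> (\<lambda>n. f n / g n) \<longlonglongrightarrow> 0"

end

theory Submission
  imports Defs
begin

text \<open>
  Write the count as a sum of indicators over injections \<open>\<beta>\<close> of \<open>{1..k}\<close> into \<open>{1..n}\<close>. Its
  \<open>j\<close>-th cumulant is the sum of the joint cumulants of all \<open>j\<close>-tuples of indicators. A joint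
  cumulant vanishes if the tuple splits into two vertex-disjoint parts, and otherwise it is
  at most \<open>j\<^sup>j p\<^sup>m\<close>, where \<open>m\<close> is the number of edges in the union of the \<open>j\<close> copies. Adding the
  copies one at a time, strong balance gives \<open>m (k - 1) \<ge> (v - 1) e(G)\<close> for a connected union
  with \<open>v\<close> vertices, and there are at most \<open>n\<^sup>v v\<^sup>k\<^sup>j\<close> tuples with \<open>v\<close> vertices. Hence the
  cumulant is at most \<open>j\<^sup>j (j k)\<^sup>k\<^sup>j\<^sup>+\<^sup>1\<close> times the largest \<open>n\<^sup>v q\<^sup>v\<^sup>-\<^sup>1\<close>, where
  \<open>q = p powr (e(G) / (k - 1))\<close>; the maximum is attained at the largest \<open>v\<close> if \<open>n q \<ge> 1\<close> and at
  \<open>v = k\<close> if \<open>n q \<le> 1\<close>. The variance is bounded below by its first-order projection in the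
  first regime and by the diagonal terms in the second.
\<close>

section \<open>Higher derivatives of smooth functions\<close>

text \<open>Strong balance merges n and p into one parameter. Since p < 1, it gives p^m <= q^(v-1),
  so the connected families with v vertices contribute, up to factors in j and k, at most n^v
  q^(v-1) = n (n q)^(v-1). This is geometric in v, and (n q)^(k-1) = n^(k-1) p^e(G), so the position
  of n q relative to 1 separates the two regimes of the theorem. The exponent 1 + k of j! is the
  price of crude counting: one factor j^j bounds a joint cumulant, k further ones list the
  embeddings inside a vertex set of size at most j k, and j^j <= e^j j!. After division by the j-th
  power of the standard deviation there remain Y^(1 - j/2), with Y = n or Y = n^k p^e(G), and a
  factor L^j with L >= 1. The latter is absorbed into the constant because j <= 6 (j/2 - 1) when j
  >= 3. The count takes finitely many values, so its generating function is a finite exponential sum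
  with a smooth logarithm on the whole line. Cumulants defined as derivatives can therefore be
  compared with moments by algebra alone.\<close>

definition smooth :: "(real \<Rightarrow> real) \<Rightarrow> bool" where
  "smooth f \<longleftrightarrow> (\<forall>i t. (deriv ^^ i) f field_differentiable (at t))"

lemma smooth_deriv: "smooth f \<Longrightarrow> smooth (deriv f)"
  unfolding smooth_def by (metis comp_apply funpow_Suc_right)

lemma smooth_differentiable: "smooth f \<Longrightarrow> f field_differentiable (at t)"
  unfolding smooth_def by (metis funpow_0)

lemma smooth_has_derivative:
  "smooth f \<Longrightarrow> ((deriv ^^ i) f has_real_derivative (deriv ^^ Suc i) f t) (at t)"
  unfolding smooth_def using field_differentiable_derivI by force

lemma smooth_coinduct:
  assumes "P f"
    and "\<And>f. P f \<Longrightarrow> (\<forall>t. f field_differentiable (at t)) \<and> P (deriv f)"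
  shows "smooth f"
proof -
  have "P ((deriv ^^ i) f)" for i
    by (induction i) (use assms in auto)
  then show ?thesis
    unfolding smooth_def using assms(2) by blast
qed

text \<open>The derivative of a product is a sum of products, so closure of \<open>smooth\<close>
  under products and inverses is not a direct coinduction. Bounding the order of differentiation
  supplies a number to induct on.\<close>

fun differentiable_upto :: "nat \<Rightarrow> (real \<Rightarrow> real) \<Rightarrow> bool" where
  "differentiable_upto 0 f = True"
| "differentiable_upto (Suc m) f =
     ((\<forall>t. f field_differentiable (at t)) \<and> differentiable_upto m (deriv f))"

lemma smooth_iff: "smooth f \<longleftrightarrow> (\<forall>m. differentiable_upto m f)"
proof
  assume "smooth f"
  then have "differentiable_upto m f" for m
    by (induction m arbitrary: f) (auto simp: smooth_deriv smooth_differentiable)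
  then show "\<forall>m. differentiable_upto m f" by blast
next
  assume "\<forall>m. differentiable_upto m f"
  then show "smooth f"
    by (rule smooth_coinduct) (metis differentiable_upto.simps(2))
qed

lemma differentiable_upto_Suc: "differentiable_upto (Suc m) f \<Longrightarrow> differentiable_upto m f"
  by (induction m arbitrary: f) auto

lemma differentiable_upto_add:
  "differentiable_upto m f \<Longrightarrow> differentiable_upto m g \<Longrightarrow> differentiable_upto m (\<lambda>t. f t + g t)"
proof (induction m arbitrary: f g)
  case (Suc m)
  then have "deriv (\<lambda>t. f t + g t) = (\<lambda>t. deriv f t + deriv g t)"
    by (intro ext deriv_add) auto
  with Suc show ?case by (auto intro: field_differentiable_add)
qed simp

lemma differentiable_upto_mult:
  "differentiable_upto m f \<Longrightarrow> differentiable_upto m g \<Longrightarrow> differentiable_upto m (\<lambda>t. f t * g t)"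
proof (induction m arbitrary: f g)
  case (Suc m)
  then have "deriv (\<lambda>t. f t * g t) = (\<lambda>t. f t * deriv g t + deriv f t * g t)"
    by (intro ext deriv_mult) auto
  moreover have "differentiable_upto m (\<lambda>t. f t * deriv g t)" "differentiable_upto m (\<lambda>t. deriv f t * g t)"
    using Suc.prems differentiable_upto_Suc[of m f] differentiable_upto_Suc[of m g]
    by (auto intro!: Suc.IH)
  ultimately show ?case
    using Suc.prems by (auto intro: field_differentiable_mult differentiable_upto_add)
qed simp

text \<open>The derivative of 1/f is -f' (1/f)^2, which needs 1/f only up to order m; the induction
  hypothesis and closure under products suffice.\<close>

lemma differentiable_upto_inverse:
  "\<forall>t. f t \<noteq> 0 \<Longrightarrow> differentiable_upto m f \<Longrightarrow> differentiable_upto m (\<lambda>t. inverse (f t))"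
proof (induction m arbitrary: f)
  case (Suc m)
  have d: "deriv (\<lambda>t. inverse (f t)) = (\<lambda>t. (-1) * deriv f t * (inverse (f t) * inverse (f t)))"
  proof
    fix t
    have "((\<lambda>t. inverse (f t)) has_real_derivative - (deriv f t * inverse (f t ^ Suc (Suc 0)))) (at t)"
      using Suc.prems by (intro DERIV_inverse_fun) (auto simp: field_differentiable_derivI)
    then show "deriv (\<lambda>t. inverse (f t)) t = (-1) * deriv f t * (inverse (f t) * inverse (f t))"
      by (auto dest!: DERIV_imp_deriv simp: field_simps)
  qed
  have const: "differentiable_upto i (\<lambda>t. c)" for i c
    by (induction i arbitrary: c) (auto simp: deriv_const[abs_def])
  have "differentiable_upto m (\<lambda>t. inverse (f t))"
    using Suc differentiable_upto_Suc by blast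
  then have "differentiable_upto m (deriv (\<lambda>t. inverse (f t)))"
    unfolding d using Suc.prems const by (intro differentiable_upto_mult) auto
  then show ?case
    using Suc.prems by (auto intro!: field_differentiable_inverse)
qed simp

lemma smooth_mult: "smooth f \<Longrightarrow> smooth g \<Longrightarrow> smooth (\<lambda>t. f t * g t)"
  by (simp add: smooth_iff differentiable_upto_mult)

lemma smooth_inverse: "smooth f \<Longrightarrow> \<forall>t. f t \<noteq> 0 \<Longrightarrow> smooth (\<lambda>t. inverse (f t))"
  by (simp add: smooth_iff differentiable_upto_inverse)

text \<open>(ln f)' = f' / f reduces logarithms to products and inverses. The same formula, read as
  f' = (ln f)' f, later yields the recursion between moments and cumulants.\<close>

lemma smooth_ln:
  assumes "smooth f" "\<forall>t. f t > 0"
  shows "smooth (\<lambda>t. ln (f t))" and "deriv (\<lambda>t. ln (f t)) = (\<lambda>t. deriv f t * inverse (f t))"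
proof -
  have *: "((\<lambda>t. ln (f t)) has_real_derivative deriv f t * inverse (f t)) (at t)" for t
    using assms smooth_has_derivative[OF assms(1), of 0 t]
    by (auto intro!: derivative_eq_intros simp: field_simps)
  then show d: "deriv (\<lambda>t. ln (f t)) = (\<lambda>t. deriv f t * inverse (f t))"
    by (auto intro: DERIV_imp_deriv)
  have "smooth (\<lambda>t. deriv f t * inverse (f t))"
    using assms by (intro smooth_mult smooth_deriv smooth_inverse) (auto, metis less_irrefl)
  then have "differentiable_upto m (\<lambda>t. ln (f t))" for m
    using * by (cases m) (auto simp: d smooth_iff field_differentiable_def)
  then show "smooth (\<lambda>t. ln (f t))"
    by (simp add: smooth_iff)
qed

lemma sum_Pow_insert:
  fixes F :: "'a set \<Rightarrow> real"
  assumes "finite S" "x \<notin> S"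
  shows "(\<Sum>T\<in>Pow (insert x S). F T) = (\<Sum>T\<in>Pow S. F T + F (insert x T))"
proof -
  have inj: "inj_on (insert x) (Pow S)"
    using assms(2) by (auto simp: inj_on_def)
  have "(\<Sum>T\<in>Pow (insert x S). F T) = (\<Sum>T\<in>Pow S. F T) + (\<Sum>T\<in>insert x ` Pow S. F T)"
    unfolding Pow_insert using assms by (intro sum.union_disjoint) auto
  then show ?thesis
    by (simp add: sum.reindex[OF inj] sum.distrib)
qed

text \<open>Indexing by subsets rather than by binomial coefficients matches the recursion that
  defines joint cumulants.\<close>

lemma Leibniz_Pow:
  fixes S :: "'a set"
  assumes "finite S" "smooth f" "smooth g"
  shows "(deriv ^^ card S) (\<lambda>t. f t * g t) =
    (\<lambda>t. \<Sum>T\<in>Pow S. (deriv ^^ card T) f t * (deriv ^^ card (S - T)) g t)"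
  using assms(1)
proof (induction S)
  case (insert x S)
  let ?D = "\<lambda>i f t. (deriv ^^ i) f t"
  have "((\<lambda>t. \<Sum>T\<in>Pow S. ?D (card T) f t * ?D (card (S - T)) g t) has_real_derivative
      (\<Sum>T\<in>Pow S. ?D (card T) f t * ?D (Suc (card (S - T))) g t + ?D (Suc (card T)) f t * ?D (card (S - T)) g t)) (at t)" for t
    by (intro DERIV_sum DERIV_mult' smooth_has_derivative assms)
  then have "?D (card (insert x S)) (\<lambda>t. f t * g t) t =
      (\<Sum>T\<in>Pow S. ?D (card T) f t * ?D (Suc (card (S - T))) g t + ?D (Suc (card T)) f t * ?D (card (S - T)) g t)" for t
    using insert by (simp add: DERIV_imp_deriv)
  also have "\<dots> t = (\<Sum>T\<in>Pow S. ?D (card T) f t * ?D (card (insert x S - T)) g t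
      + ?D (card (insert x T)) f t * ?D (card (insert x S - insert x T)) g t)" for t
  proof (rule sum.cong[OF refl])
    fix T assume T: "T \<in> Pow S"
    then have "x \<notin> T" "finite T" "insert x S - T = insert x (S - T)" "insert x S - insert x T = S - T"
      using insert finite_subset by auto
    then show "?D (card T) f t * ?D (Suc (card (S - T))) g t + ?D (Suc (card T)) f t * ?D (card (S - T)) g t
      = ?D (card T) f t * ?D (card (insert x S - T)) g t
      + ?D (card (insert x T)) f t * ?D (card (insert x S - insert x T)) g t"
      using insert by simp
  qed
  finally show ?case
    by (intro ext) (simp only: sum_Pow_insert[OF insert.hyps])
qed simp

lemma higher_deriv_scale:
  assumes "smooth f"
  shows "(deriv ^^ j) (\<lambda>t. a * f (c * t)) = (\<lambda>t. a * c ^ j * (deriv ^^ j) f (c * t))"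
proof (induction j)
  case (Suc j)
  have "((\<lambda>t. a * c ^ j * (deriv ^^ j) f (c * t)) has_real_derivative
      a * c ^ Suc j * (deriv ^^ Suc j) f (c * t)) (at t)" for t
    using DERIV_cmult[OF DERIV_chain2[OF smooth_has_derivative[OF assms] DERIV_cmult_Id[of c t]], of "a * c ^ j" j]
    by (simp add: mult_ac)
  then show ?case
    using Suc by (auto simp: DERIV_imp_deriv)
qed simp

text \<open>The linear term becomes constant after one differentiation and disappears after two,
  hence j >= 2. Two derivatives are taken by hand and the remaining j - 2 only rescale.\<close>

lemma higher_deriv_affine:
  assumes "smooth f" "j \<ge> 2"
  shows "(deriv ^^ j) (\<lambda>t. f (c * t) + b * t) = (\<lambda>t. c ^ j * (deriv ^^ j) f (c * t))"
proof -
  obtain i where j: "j = Suc (Suc i)"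
    using le_Suc_ex[OF assms(2)] by auto
  have d1: "((\<lambda>t. f (c * t)) has_real_derivative c * deriv f (c * t)) (at t)" for t
    using DERIV_chain2[OF smooth_has_derivative[OF assms(1), of 0] DERIV_cmult_Id[of c t]]
    by (simp add: mult_ac)
  have d2: "((\<lambda>t. deriv f (c * t)) has_real_derivative c * deriv (deriv f) (c * t)) (at t)" for t
    using DERIV_chain2[OF smooth_has_derivative[OF assms(1), of 1] DERIV_cmult_Id[of c t]]
    by (simp add: mult_ac)
  have "deriv (\<lambda>t. f (c * t) + b * t) = (\<lambda>t. c * deriv f (c * t) + b)"
    by (intro ext DERIV_imp_deriv) (auto intro!: derivative_eq_intros d1)
  then have "deriv (deriv (\<lambda>t. f (c * t) + b * t)) = (\<lambda>t. c ^ 2 * deriv (deriv f) (c * t))"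
    by (auto intro!: ext DERIV_imp_deriv derivative_eq_intros d2 simp: power2_eq_square)
  then have "(deriv ^^ j) (\<lambda>t. f (c * t) + b * t) = (deriv ^^ i) (\<lambda>t. c ^ 2 * deriv (deriv f) (c * t))"
    unfolding j by (simp only: funpow_Suc_right comp_apply)
  also have "\<dots> = (\<lambda>t. c ^ 2 * c ^ i * (deriv ^^ i) (deriv (deriv f)) (c * t))"
    by (rule higher_deriv_scale) (simp add: assms smooth_deriv)
  finally show ?thesis
    unfolding j by (simp only: funpow_Suc_right comp_apply power_Suc power2_eq_square mult_ac)
qed

section \<open>Moments, cumulants and joint cumulants\<close>

lemma smooth_exp_sum:
  fixes w :: "real \<Rightarrow> real"
  assumes "finite F"
  shows "smooth (\<lambda>t. \<Sum>y\<in>F. w y * exp (t * y))"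
    and "(deriv ^^ j) (\<lambda>t. \<Sum>y\<in>F. w y * exp (t * y)) = (\<lambda>t. \<Sum>y\<in>F. w y * y ^ j * exp (t * y))"
proof -
  have d: "((\<lambda>t. \<Sum>y\<in>F. v y * exp (t * y)) has_real_derivative (\<Sum>y\<in>F. v y * y * exp (t * y))) (at t)"
    for v :: "real \<Rightarrow> real" and t
    by (auto intro!: derivative_eq_intros sum.cong)
  have D: "(deriv ^^ j) (\<lambda>t. \<Sum>y\<in>F. w y * exp (t * y)) = (\<lambda>t. \<Sum>y\<in>F. w y * y ^ j * exp (t * y))" for j
  proof (induction j)
    case (Suc j)
    have "deriv (\<lambda>t. \<Sum>y\<in>F. w y * y ^ j * exp (t * y)) = (\<lambda>t. \<Sum>y\<in>F. w y * y ^ j * y * exp (t * y))"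
      by (intro ext DERIV_imp_deriv d)
    with Suc show ?case
      by (simp add: mult_ac)
  qed simp
  then show "(deriv ^^ j) (\<lambda>t. \<Sum>y\<in>F. w y * exp (t * y)) = (\<lambda>t. \<Sum>y\<in>F. w y * y ^ j * exp (t * y))" .
  show "smooth (\<lambda>t. \<Sum>y\<in>F. w y * exp (t * y))"
    unfolding smooth_def D field_differentiable_def by (intro allI exI) (rule d)
qed

context prob_space
begin

lemma expectation_simple_function:
  fixes Y :: "'a \<Rightarrow> real" and g :: "real \<Rightarrow> real"
  assumes Y: "simple_function M Y"
  shows "expectation (\<lambda>\<omega>. g (Y \<omega>)) = (\<Sum>y\<in>Y ` space M. prob (Y -` {y} \<inter> space M) * g y)"
proof -
  have fin: "finite (Y ` space M)"
    using Y by (rule simple_functionD)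
  have "expectation (\<lambda>\<omega>. g (Y \<omega>)) = expectation (\<lambda>\<omega>. \<Sum>y\<in>Y ` space M. indicator (Y -` {y} \<inter> space M) \<omega> * g y)"
    using fin by (intro Bochner_Integration.integral_cong)
      (auto simp: indicator_def sum.delta if_distrib[of "\<lambda>z. z * _"] cong: if_cong)
  also have "\<dots> = (\<Sum>y\<in>Y ` space M. expectation (\<lambda>\<omega>. indicator (Y -` {y} \<inter> space M) \<omega> * g y))"
    using simple_functionD(2)[OF Y]
    by (intro Bochner_Integration.integral_sum integrable_mult_left integrable_real_indicator)
      (auto simp: emeasure_eq_measure)
  also have "\<dots> = (\<Sum>y\<in>Y ` space M. prob (Y -` {y} \<inter> space M) * g y)"
    by (intro sum.cong) auto
  finally show ?thesis .
qed

lemma integrable_simple_function: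
  fixes Y :: "'a \<Rightarrow> real"
  assumes Y: "simple_function M Y"
  shows "integrable M Y"
proof (rule integrable_const_bound)
  have "\<bar>Y x\<bar> \<le> Max (abs ` Y ` space M)" if "x \<in> space M" for x
    using that simple_functionD(1)[OF Y] by (intro Max_ge) auto
  then show "AE x in M. norm (Y x) \<le> Max (abs ` Y ` space M)"
    by (auto intro: AE_I2)
  show "Y \<in> borel_measurable M"
    by (rule borel_measurable_simple_function[OF Y])
qed

text \<open>For a finite-valued variable the integral is a finite sum of exponentials, so
  derivatives are taken term by term and no interchange with the integral has to be
  justified.\<close>

lemma moment_generating_function:
  fixes Y :: "'a \<Rightarrow> real"
  assumes Y: "simple_function M Y"
  shows "smooth (\<lambda>t. expectation (\<lambda>\<omega>. exp (t * Y \<omega>)))"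
    and "(deriv ^^ j) (\<lambda>t. expectation (\<lambda>\<omega>. exp (t * Y \<omega>))) 0 = expectation (\<lambda>\<omega>. Y \<omega> ^ j)"
    and "expectation (\<lambda>\<omega>. exp (t * Y \<omega>)) > 0"
proof -
  have fin: "finite (Y ` space M)"
    using Y by (rule simple_functionD)
  have eq: "(\<lambda>t. expectation (\<lambda>\<omega>. exp (t * Y \<omega>))) =
      (\<lambda>t. \<Sum>y\<in>Y ` space M. prob (Y -` {y} \<inter> space M) * exp (t * y))"
    using expectation_simple_function[OF Y, of "\<lambda>y. exp (_ * y)"] by auto
  show "smooth (\<lambda>t. expectation (\<lambda>\<omega>. exp (t * Y \<omega>)))"
    unfolding eq by (rule smooth_exp_sum[OF fin])
  show "(deriv ^^ j) (\<lambda>t. expectation (\<lambda>\<omega>. exp (t * Y \<omega>))) 0 = expectation (\<lambda>\<omega>. Y \<omega> ^ j)"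
    unfolding eq smooth_exp_sum(2)[OF fin]
    using expectation_simple_function[OF Y, of "\<lambda>y. y ^ j"] by simp
  have "integrable M (\<lambda>\<omega>. exp (t * Y \<omega>))"
    using simple_function_compose[OF Y, of "\<lambda>y. exp (t * y)"]
    by (intro integrable_simple_function) (simp add: comp_def)
  then show "expectation (\<lambda>\<omega>. exp (t * Y \<omega>)) > 0"
    by (intro expectation_greater) auto
qed

text \<open>Differentiate m' = K' m, where m is the generating function and K = ln m, as often as S
  has elements, and evaluate at 0. The set S only indexes the Leibniz rule.\<close>

lemma moment_eq_sum_cumulants:
  fixes Y :: "'a \<Rightarrow> real" and S :: "'b set"
  assumes Y: "simple_function M Y" and S: "finite S"
  shows "expectation (\<lambda>\<omega>. Y \<omega> ^ Suc (card S)) =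
    (\<Sum>T\<in>Pow S. cumulant M (Suc (card T)) Y * expectation (\<lambda>\<omega>. Y \<omega> ^ card (S - T)))"
proof -
  let ?m = "\<lambda>t. expectation (\<lambda>\<omega>. exp (t * Y \<omega>))"
  let ?K = "\<lambda>t. ln (?m t)"
  note mgf = moment_generating_function[OF Y]
  have K: "smooth ?K" "deriv ?K = (\<lambda>t. deriv ?m t * inverse (?m t))"
    using smooth_ln[OF mgf(1)] mgf(3) by blast+
  have "?m t \<noteq> 0" for t
    using mgf(3)[of t] by simp
  then have "deriv ?m = (\<lambda>t. deriv ?K t * ?m t)"
    by (simp add: K(2) fun_eq_iff)
  then have "(deriv ^^ Suc (card S)) ?m 0 = (deriv ^^ card S) (\<lambda>t. deriv ?K t * ?m t) 0"
    by (simp only: funpow_Suc_right comp_apply)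
  also have "\<dots> = (\<Sum>T\<in>Pow S. (deriv ^^ card T) (deriv ?K) 0 * (deriv ^^ card (S - T)) ?m 0)"
    by (simp only: Leibniz_Pow[OF S smooth_deriv[OF K(1)] mgf(1)])
  finally show ?thesis
    unfolding mgf(2) cumulant_def by (simp only: funpow_Suc_right comp_apply)
qed

lemma cumulant_affine:
  fixes Y :: "'a \<Rightarrow> real"
  assumes Y: "simple_function M Y" and j: "j \<ge> 2"
  shows "cumulant M j (\<lambda>\<omega>. c * Y \<omega> + b) = c ^ j * cumulant M j Y"
proof -
  let ?m = "\<lambda>t. expectation (\<lambda>\<omega>. exp (t * Y \<omega>))"
  note mgf = moment_generating_function[OF Y]
  have "expectation (\<lambda>\<omega>. exp (t * (c * Y \<omega> + b))) = exp (b * t) * ?m (c * t)" for t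
    by (subst Bochner_Integration.integral_mult_right_zero[symmetric])
      (simp add: exp_add[symmetric] algebra_simps)
  then have "ln (expectation (\<lambda>\<omega>. exp (t * (c * Y \<omega> + b)))) = ln (?m (c * t)) + b * t" for t
    using mgf(3)[of "c * t"] by (simp add: ln_mult)
  moreover have "smooth (\<lambda>t. ln (?m t))"
    using smooth_ln(1)[OF mgf(1)] mgf(3) by blast
  ultimately show ?thesis
    unfolding cumulant_def using higher_deriv_affine[OF _ j, of "\<lambda>t. ln (?m t)" c b] by simp
qed

text \<open>Orders 1 and 2 of the moment recursion: E Y = \<kappa>1 and E Y^2 = \<kappa>1 E Y +
  \<kappa>2. The sets \<open>{}\<close> and \<open>{()}\<close> serve as index sets of sizes 0 and
  1.\<close>

lemma cumulant_2:
  fixes Y :: "'a \<Rightarrow> real"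
  assumes Y: "simple_function M Y"
  shows "cumulant M 2 Y = expectation (\<lambda>\<omega>. (Y \<omega>)\<^sup>2) - (expectation Y)\<^sup>2"
  using moment_eq_sum_cumulants[OF Y, of "{}"] moment_eq_sum_cumulants[OF Y, of "{()}"]
  by (simp add: Pow_insert numeral_2_eq_2 prob_space power2_eq_square)

end

section \<open>Joint cumulants on finite index sets: recursion, multilinearity, vanishing and
  size\<close>

function joint_cumulant :: "(nat set \<Rightarrow> real) \<Rightarrow> nat set \<Rightarrow> real" where
  "joint_cumulant m S =
     m S - (\<Sum>T\<in>{T. finite S \<and> T \<subset> S \<and> Min S \<in> T}. joint_cumulant m T * m (S - T))"
  by pat_completeness auto
text \<open>The guard \<open>finite S\<close> empties the sum for infinite S, where
  \<open>card\<close> would not decrease.\<close>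

termination
  by (relation "Wellfounded.measure (\<lambda>(m, S). card S)") (auto intro: psubset_card_mono)

declare joint_cumulant.simps [simp del]

text \<open>\<open>joint_cumulant\<close> is the classical formula that writes m(S) as the sum of
  \<kappa>(T) m(S - T) over the blocks T containing a fixed element, solved for the top block T = S.
  This avoids set partitions and their Moebius coefficients. Here a block is coded by its elements
  other than \<open>Min S\<close>.\<close>

lemma joint_cumulant_rec:
  assumes "finite S" "S \<noteq> {}"
  defines "S' \<equiv> S - {Min S}"
  shows "joint_cumulant m S =
    m S - (\<Sum>T\<in>Pow S' - {S'}. joint_cumulant m (insert (Min S) T) * m (S' - T))"
proof -
  have s: "Min S \<in> S"
    using assms by simp
  have "(\<Sum>T\<in>{T. finite S \<and> T \<subset> S \<and> Min S \<in> T}. joint_cumulant m T * m (S - T))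
      = (\<Sum>T\<in>Pow S' - {S'}. joint_cumulant m (insert (Min S) T) * m (S' - T))"
  proof (rule sum.reindex_bij_witness[of _ "insert (Min S)" "\<lambda>T. T - {Min S}"])
    fix T assume T: "T \<in> {T. finite S \<and> T \<subset> S \<and> Min S \<in> T}"
    then have "insert (Min S) T = T" "S' - (T - {Min S}) = S - T"
      by (auto simp: S'_def)
    then show "joint_cumulant m (insert (Min S) (T - {Min S})) * m (S' - (T - {Min S})) = joint_cumulant m T * m (S - T)"
      by simp
  qed (use s assms(1) in \<open>auto simp: S'_def\<close>)
  then show ?thesis
    by (simp add: joint_cumulant.simps[of m S])
qed

text \<open>The index T = S' contributes \<open>joint_cumulant m S\<close> itself, since its
  cofactor is \<open>m {}\<close> = 1.\<close>

lemma moment_eq_sum_joint_cumulants: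
  assumes "finite S" "S \<noteq> {}" "m {} = 1"
  defines "S' \<equiv> S - {Min S}"
  shows "m S = (\<Sum>T\<in>Pow S'. joint_cumulant m (insert (Min S) T) * m (S' - T))"
proof -
  have "insert (Min S) S' = S"
    using Min_in[OF assms(1,2)] by (auto simp: S'_def)
  then show ?thesis
    using assms joint_cumulant_rec[OF assms(1,2), of m]
    by (subst sum.remove[of _ S']) (auto simp: S'_def)
qed

lemma joint_cumulant_cong:
  assumes "finite S" "\<And>T. T \<subseteq> S \<Longrightarrow> m T = m' T"
  shows "joint_cumulant m S = joint_cumulant m' S"
  using assms
proof (induction S rule: finite_psubset_induct)
  case (psubset S)
  show ?case
    unfolding joint_cumulant.simps[of _ S]
    by (intro arg_cong2[of _ _ _ _ "(-)"] sum.cong arg_cong2[of _ _ _ _ "(*)"] psubset) auto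
qed

lemma sum_PiE_split:
  fixes F G :: "('i \<Rightarrow> 'b) \<Rightarrow> real"
  assumes "U \<subseteq> S"
    and F: "\<And>\<alpha>. F (restrict \<alpha> U) = F \<alpha>" and G: "\<And>\<alpha>. G (restrict \<alpha> (S - U)) = G \<alpha>"
  shows "(\<Sum>\<alpha>\<in>S \<rightarrow>\<^sub>E A. F \<alpha> * G \<alpha>) = (\<Sum>\<alpha>\<in>U \<rightarrow>\<^sub>E A. F \<alpha>) * (\<Sum>\<alpha>\<in>(S - U) \<rightarrow>\<^sub>E A. G \<alpha>)"
proof -
  have "(\<Sum>\<alpha>\<in>S \<rightarrow>\<^sub>E A. F \<alpha> * G \<alpha>) = (\<Sum>(\<alpha>, \<beta>)\<in>(U \<rightarrow>\<^sub>E A) \<times> ((S - U) \<rightarrow>\<^sub>E A). F \<alpha> * G \<beta>)"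
  proof (rule sum.reindex_bij_witness[of _ "\<lambda>(\<alpha>, \<beta>) i. if i \<in> U then \<alpha> i else \<beta> i" "\<lambda>\<alpha>. (restrict \<alpha> U, restrict \<alpha> (S - U))"])
    fix \<alpha> assume "\<alpha> \<in> S \<rightarrow>\<^sub>E A"
    then show "(case (restrict \<alpha> U, restrict \<alpha> (S - U)) of (\<alpha>, \<beta>) \<Rightarrow> \<lambda>i. if i \<in> U then \<alpha> i else \<beta> i) = \<alpha>"
      using assms(1) by (auto simp: fun_eq_iff PiE_iff extensional_def)
    show "(restrict \<alpha> U, restrict \<alpha> (S - U)) \<in> (U \<rightarrow>\<^sub>E A) \<times> ((S - U) \<rightarrow>\<^sub>E A)"
      using assms(1) \<open>\<alpha> \<in> S \<rightarrow>\<^sub>E A\<close> by (auto simp: PiE_iff)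
  next
    fix z assume z: "z \<in> (U \<rightarrow>\<^sub>E A) \<times> ((S - U) \<rightarrow>\<^sub>E A)"
    then show "(case z of (\<alpha>, \<beta>) \<Rightarrow> \<lambda>i. if i \<in> U then \<alpha> i else \<beta> i) \<in> S \<rightarrow>\<^sub>E A"
      using assms(1) by (auto simp: PiE_iff extensional_def)
    show "(restrict (case z of (\<alpha>, \<beta>) \<Rightarrow> \<lambda>i. if i \<in> U then \<alpha> i else \<beta> i) U,
        restrict (case z of (\<alpha>, \<beta>) \<Rightarrow> \<lambda>i. if i \<in> U then \<alpha> i else \<beta> i) (S - U)) = z"
      using z by (auto simp: fun_eq_iff PiE_iff extensional_def)
  qed (simp add: F G)
  then show ?thesis
    by (simp add: sum_product sum.cartesian_product)
qed

lemma simple_function_prod: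
  fixes f :: "'i \<Rightarrow> 'a \<Rightarrow> real"
  assumes "\<And>i. i \<in> T \<Longrightarrow> simple_function M (f i)"
  shows "simple_function M (\<lambda>\<omega>. \<Prod>i\<in>T. f i \<omega>)"
  using assms by (induction T rule: infinite_finite_induct) (auto intro: simple_function_mult)

text \<open>Multilinearity of cumulants, obtained by comparing two recursions. Expanding the moments
  of the sum over all \<alpha>, and then splitting each \<alpha> at a block, shows that the
  right-hand side obeys the recursion satisfied by the cumulants of the sum.\<close>

lemma (in prob_space) cumulant_sum:
  fixes I :: "'i \<Rightarrow> 'a \<Rightarrow> real" and S :: "nat set"
  assumes A: "finite A" and I: "\<And>a. a \<in> A \<Longrightarrow> simple_function M (I a)"
    and S: "finite S" "S \<noteq> {}"
  defines "m \<equiv> \<lambda>\<alpha> S. expectation (\<lambda>\<omega>. \<Prod>i\<in>S. I (\<alpha> i) \<omega>)"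
  shows "cumulant M (card S) (\<lambda>\<omega>. \<Sum>a\<in>A. I a \<omega>) = (\<Sum>\<alpha>\<in>S \<rightarrow>\<^sub>E A. joint_cumulant (m \<alpha>) S)"
  using S
proof (induction S rule: finite_psubset_induct)
  case (psubset S)
  let ?Y = "\<lambda>\<omega>. \<Sum>a\<in>A. I a \<omega>"
  have Y: "simple_function M ?Y"
    using A I by (intro simple_function_sum) auto
  have simple_prod: "simple_function M (\<lambda>\<omega>. \<Prod>i\<in>T. I (\<alpha> i) \<omega>)" if "finite T" "\<alpha> \<in> T \<rightarrow>\<^sub>E A" for \<alpha> and T :: "nat set"
    using that I by (intro simple_function_prod) auto
  have moment: "expectation (\<lambda>\<omega>. ?Y \<omega> ^ card T) = (\<Sum>\<alpha>\<in>T \<rightarrow>\<^sub>E A. m \<alpha> T)" if T: "finite T" for T :: "nat set"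
  proof -
    have "?Y \<omega> ^ card T = (\<Sum>\<alpha>\<in>T \<rightarrow>\<^sub>E A. \<Prod>i\<in>T. I (\<alpha> i) \<omega>)" for \<omega>
      using prod_sum_PiE[OF T A, of "\<lambda>_ a. I a \<omega>"] by simp
    then show ?thesis
      unfolding m_def by (simp add: Bochner_Integration.integral_sum integrable_simple_function simple_prod T)
  qed
  have m0: "m \<alpha> {} = 1" for \<alpha>
    by (simp add: m_def prob_space)
  define s where "s = Min S"
  define S' where "S' = S - {s}"
  have s: "s \<in> S" "s \<notin> S'" "S = insert s S'" "finite S'" "card S = Suc (card S')"
    using psubset.hyps Min_in[OF psubset.hyps psubset.prems] card_Suc_Diff1[OF psubset.hyps Min_in[OF psubset.hyps psubset.prems]]
    by (auto simp: s_def S'_def)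
  let ?c = "\<lambda>T. \<Sum>\<alpha>\<in>insert s T \<rightarrow>\<^sub>E A. joint_cumulant (m \<alpha>) (insert s T)"
  have m_restrict: "m (restrict \<alpha> U) T = m \<alpha> T" if "T \<subseteq> U" for \<alpha> U T
    unfolding m_def using that by (intro Bochner_Integration.integral_cong prod.cong) auto
  have "expectation (\<lambda>\<omega>. ?Y \<omega> ^ card S) = (\<Sum>\<alpha>\<in>S \<rightarrow>\<^sub>E A. \<Sum>T\<in>Pow S'. joint_cumulant (m \<alpha>) (insert s T) * m \<alpha> (S' - T))"
    unfolding moment[OF psubset.hyps(1)]
    using moment_eq_sum_joint_cumulants[OF psubset.hyps(1) psubset.prems, of "m \<alpha>" for \<alpha>] m0
    by (simp add: s_def S'_def)
  also have "\<dots> = (\<Sum>T\<in>Pow S'. \<Sum>\<alpha>\<in>S \<rightarrow>\<^sub>E A. joint_cumulant (m \<alpha>) (insert s T) * m \<alpha> (S' - T))"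
    by (rule sum.swap)
  also have "\<dots> = (\<Sum>T\<in>Pow S'. ?c T * expectation (\<lambda>\<omega>. ?Y \<omega> ^ card (S' - T)))"
  proof (rule sum.cong[OF refl])
    fix T assume T: "T \<in> Pow S'"
    have diff: "S - insert s T = S' - T"
      by (auto simp: S'_def)
    have "finite T"
      using T s finite_subset by auto
    have "(\<Sum>\<alpha>\<in>S \<rightarrow>\<^sub>E A. joint_cumulant (m \<alpha>) (insert s T) * m \<alpha> (S' - T))
      = ?c T * (\<Sum>\<alpha>\<in>(S - insert s T) \<rightarrow>\<^sub>E A. m \<alpha> (S' - T))"
      using T s \<open>finite T\<close>
      by (intro sum_PiE_split joint_cumulant_cong m_restrict) (auto simp: m_restrict)
    then show "(\<Sum>\<alpha>\<in>S \<rightarrow>\<^sub>E A. joint_cumulant (m \<alpha>) (insert s T) * m \<alpha> (S' - T))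
      = ?c T * expectation (\<lambda>\<omega>. ?Y \<omega> ^ card (S' - T))"
      using s by (simp add: diff moment)
  qed
  finally have 1: "expectation (\<lambda>\<omega>. ?Y \<omega> ^ card S) = (\<Sum>T\<in>Pow S'. ?c T * expectation (\<lambda>\<omega>. ?Y \<omega> ^ card (S' - T)))" .
  have 2: "expectation (\<lambda>\<omega>. ?Y \<omega> ^ card S) = (\<Sum>T\<in>Pow S'. cumulant M (Suc (card T)) ?Y * expectation (\<lambda>\<omega>. ?Y \<omega> ^ card (S' - T)))"
    using moment_eq_sum_cumulants[OF Y s(4)] s(5) by simp
  have 3: "?c T = cumulant M (Suc (card T)) ?Y" if "T \<in> Pow S' - {S'}" for T
  proof -
    have "s \<notin> T" "finite T"
      using that s(2,4) finite_subset[of T S'] by auto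
    moreover have "insert s T \<subset> S"
      using that s(1-3) by auto
    ultimately have "insert s T \<subset> S" "card (insert s T) = Suc (card T)"
      by auto
    then show ?thesis
      using psubset.IH[of "insert s T"] by simp
  qed
  have "(\<Sum>T\<in>Pow S' - {S'}. ?c T * expectation (\<lambda>\<omega>. ?Y \<omega> ^ card (S' - T)))
     = (\<Sum>T\<in>Pow S' - {S'}. cumulant M (Suc (card T)) ?Y * expectation (\<lambda>\<omega>. ?Y \<omega> ^ card (S' - T)))"
    by (intro sum.cong refl arg_cong2[of _ _ _ _ "(*)"] 3)
  \<comment> \<open>Proper blocks agree by induction, so two expansions of the same moment can
    differ only in the term T = S', whose cofactor is 1.\<close>
  with 1 2 have "?c S' = cumulant M (Suc (card S')) ?Y"
    using s(4) sum.remove[of "Pow S'" S' "\<lambda>T. ?c T * expectation (\<lambda>\<omega>. ?Y \<omega> ^ card (S' - T))"]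
      sum.remove[of "Pow S'" S' "\<lambda>T. cumulant M (Suc (card T)) ?Y * expectation (\<lambda>\<omega>. ?Y \<omega> ^ card (S' - T))"]
    by (simp add: prob_space)
  then show ?case
    using s by simp
qed

text \<open>In the recursion for m(U), a proper block that meets both parts contributes 0 by
  induction. The other proper blocks lie in the part P' containing \<open>Min U\<close>; their
  cofactors split off m(U \<inter> Q'), and the rest resums to m(U \<inter> P'). Hence m(U) =
  \<kappa>(U) + m(U \<inter> P') m(U \<inter> Q'), and the factorization of m leaves \<kappa>(U) =
  0.\<close>

lemma joint_cumulant_eq_0:
  assumes "finite U" "U \<subseteq> P \<union> Q" "P \<inter> Q = {}" "m {} = 1"
    and m: "\<And>T. T \<subseteq> U \<Longrightarrow> m T = m (T \<inter> P) * m (T \<inter> Q)"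
    and "U \<inter> P \<noteq> {}" "U \<inter> Q \<noteq> {}"
  shows "joint_cumulant m U = 0"
  using assms
proof (induction U arbitrary: P Q rule: finite_psubset_induct)
  case (psubset U)
  have U_ne: "U \<noteq> {}" and m0: "m {} = 1" and fin: "finite U"
    using psubset.hyps psubset.prems(3,5) by auto
  \<comment> \<open>The recursion distinguishes \<open>Min U\<close>, so the argument is stated for
    whichever of the two parts contains it.\<close>
  have main: "joint_cumulant m U = 0"
    if s: "Min U \<in> P'" and U: "U \<subseteq> P' \<union> Q'" "P' \<inter> Q' = {}" "U \<inter> Q' \<noteq> {}"
      and m: "\<And>T. T \<subseteq> U \<Longrightarrow> m T = m (T \<inter> P') * m (T \<inter> Q')" for P' Q'
  proof -
    define s where "s = Min U"
    define U' where "U' = U - {s}"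
    have sU: "s \<in> U" "U \<noteq> {}" "s \<in> P'"
      using Min_in[OF fin U_ne] U_ne s by (auto simp: s_def)
    have UP: "Min (U \<inter> P') = s" "finite (U \<inter> P')"
      using fin sU Min_le[OF fin] by (auto simp flip: s_def intro!: Min_eqI)
    have U'P: "U \<inter> P' - {s} = U' \<inter> P'"
      by (auto simp: U'_def)
    let ?f = "\<lambda>T. joint_cumulant m (insert s T) * m (U' - T)"
    have "m U = (\<Sum>T\<in>Pow U'. ?f T)"
      using moment_eq_sum_joint_cumulants[of U m, OF fin U_ne m0] by (simp add: s_def U'_def)
    also have "\<dots> = ?f U' + (\<Sum>T\<in>Pow U' - {U'}. ?f T)"
      using fin by (intro sum.remove) (auto simp: U'_def)
    also have "(\<Sum>T\<in>Pow U' - {U'}. ?f T) = (\<Sum>T\<in>Pow (U' \<inter> P'). ?f T)"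
    proof (rule sum.mono_neutral_right)
      show "finite (Pow U' - {U'})"
        using fin by (auto simp: U'_def)
      show "Pow (U' \<inter> P') \<subseteq> Pow U' - {U'}"
        using U sU by (auto simp: U'_def)
      show "\<forall>T\<in>Pow U' - {U'} - Pow (U' \<inter> P'). ?f T = 0"
      proof
        fix T assume T: "T \<in> Pow U' - {U'} - Pow (U' \<inter> P')"
        have "joint_cumulant m (insert s T) = 0"
        proof (rule psubset.IH[of "insert s T" P' Q'])
          show TU: "insert s T \<subset> U"
            using T sU by (auto simp: U'_def)
          then show "m V = m (V \<inter> P') * m (V \<inter> Q')" if "V \<subseteq> insert s T" for V
            using that by (intro m) auto
        qed (use T U sU m0 in \<open>auto simp: U'_def\<close>)
        then show "?f T = 0" by simp
      qed
    qed
    also have "(\<Sum>T\<in>Pow (U' \<inter> P'). ?f T) =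
        (\<Sum>T\<in>Pow (U' \<inter> P'). joint_cumulant m (insert s T) * m (U' \<inter> P' - T)) * m (U \<inter> Q')"
      unfolding sum_distrib_right
    proof (rule sum.cong[OF refl])
      fix T assume T: "T \<in> Pow (U' \<inter> P')"
      have "(U' - T) \<inter> P' = U' \<inter> P' - T" "(U' - T) \<inter> Q' = U \<inter> Q'"
        using T U sU by (auto simp: U'_def)
      moreover have "U' - T \<subseteq> U"
        by (auto simp: U'_def)
      ultimately have "m (U' - T) = m (U' \<inter> P' - T) * m (U \<inter> Q')"
        using m[of "U' - T"] by metis
      then show "?f T = joint_cumulant m (insert s T) * m (U' \<inter> P' - T) * m (U \<inter> Q')"
        by (simp only: mult.assoc)
    qed
    also have "(\<Sum>T\<in>Pow (U' \<inter> P'). joint_cumulant m (insert s T) * m (U' \<inter> P' - T)) = m (U \<inter> P')"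
      using moment_eq_sum_joint_cumulants[of "U \<inter> P'" m, OF UP(2) _ m0, unfolded UP(1) U'P] sU(1,3)
      by fastforce
    finally have "m U = ?f U' + m (U \<inter> P') * m (U \<inter> Q')" .
    moreover have "?f U' = joint_cumulant m U"
      using insert_Diff[OF sU(1)] m0 by (simp add: U'_def)
    ultimately show ?thesis
      using m[OF subset_refl] by linarith
  qed
  have "Min U \<in> U"
    using fin U_ne by (rule Min_in)
  then consider "Min U \<in> P" | "Min U \<in> Q"
    using psubset.prems(1) by auto
  then show ?case
  proof cases
    case 1
    then show ?thesis
      by (rule main[OF _ psubset.prems(1,2,6,4)])
  next
    case 2
    have "m T = m (T \<inter> Q) * m (T \<inter> P)" if "T \<subseteq> U" for T
      using psubset.prems(4)[OF that] by (simp only: mult.commute)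
    with 2 show ?thesis
      using psubset.prems(1,2,5) by (intro main[of Q P]) (simp_all add: Un_commute Int_commute)
  qed
qed

text \<open>The majorant b is supermultiplicative on disjoint sets, so each product \<kappa>(T) m(S
  - T) is at most a multiple of b(S). With r = |S| - 1 these multiples, together with the one for
  m(S), add up by the binomial theorem over subsets to 1 + (r + 1)^r - r^r <= (r + 1)^r.\<close>

lemma joint_cumulant_bound:
  assumes "finite S" "S \<noteq> {}"
    and m: "\<And>T. T \<subseteq> S \<Longrightarrow> \<bar>m T\<bar> \<le> b T"
    and b: "\<And>T U. T \<union> U \<subseteq> S \<Longrightarrow> T \<inter> U = {} \<Longrightarrow> b T * b U \<le> b (T \<union> U)"
  shows "\<bar>joint_cumulant m S\<bar> \<le> real (card S) ^ (card S - 1) * b S"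
  using assms
proof (induction S rule: finite_psubset_induct)
  case (psubset S)
  have b0: "b T \<ge> 0" if "T \<subseteq> S" for T
    using psubset.prems(2)[OF that] by linarith
  define s where "s = Min S"
  define S' where "S' = S - {s}"
  define r where "r = card S'"
  have s: "s \<in> S" "s \<notin> S'" "S = insert s S'" "finite S'" "card S = Suc r"
    using psubset.hyps Min_in[OF psubset.hyps psubset.prems(1)]
      card_Suc_Diff1[OF psubset.hyps Min_in[OF psubset.hyps psubset.prems(1)]]
    by (auto simp: s_def S'_def r_def)
  \<comment> \<open>For proper T the block \<open>insert s T\<close> has at most r elements, so its
    inductive factor (card T + 1)^(card T) is at most r^(card T).\<close>
  have *: "\<bar>joint_cumulant m (insert s T) * m (S' - T)\<bar> \<le> real r ^ card T * b S" if T: "T \<in> Pow S' - {S'}" for T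
  proof -
    have "finite T" "card T < r"
      using T s psubset_card_mono[OF s(4), of T] finite_subset by (auto simp: r_def)
    moreover have "s \<notin> T"
      using T s(2) by auto
    ultimately have c: "card (insert s T) = Suc (card T)" "Suc (card T) \<le> r"
      by auto
    have sub: "insert s T \<subset> S" "insert s T \<union> (S' - T) = S" "insert s T \<inter> (S' - T) = {}"
      using T s by auto
    have bb: "b (insert s T) * b (S' - T) \<le> b S"
      using psubset.prems(3)[of "insert s T" "S' - T", unfolded sub(2), OF subset_refl sub(3)] .
    have "\<bar>joint_cumulant m (insert s T)\<bar> \<le> real (Suc (card T)) ^ card T * b (insert s T)"
    proof -
      have "\<bar>joint_cumulant m (insert s T)\<bar> \<le> real (card (insert s T)) ^ (card (insert s T) - 1) * b (insert s T)"
        using sub(1) by (intro psubset.IH psubset.prems) auto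
      then show ?thesis using c by simp
    qed
    moreover have "\<bar>m (S' - T)\<bar> \<le> b (S' - T)"
      using psubset.prems(2)[of "S' - T"] by (auto simp: S'_def)
    ultimately have "\<bar>joint_cumulant m (insert s T) * m (S' - T)\<bar> \<le> real (Suc (card T)) ^ card T * b (insert s T) * b (S' - T)"
      unfolding abs_mult using b0[of "insert s T"] sub by (intro mult_mono) auto
    also have "\<dots> \<le> real (Suc (card T)) ^ card T * b S"
      unfolding mult.assoc using bb by (intro mult_left_mono) auto
    also have "\<dots> \<le> real r ^ card T * b S"
      using c b0[of S] by (intro mult_right_mono power_mono) auto
    finally show ?thesis .
  qed
  have "(\<Sum>T\<in>Pow S'. real r ^ card T) = (real r + 1) ^ r"
    using prod_add[OF s(4), of "\<lambda>_. real r" "\<lambda>_. 1"] by (simp add: r_def)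
  then have sum: "(\<Sum>T\<in>Pow S' - {S'}. real r ^ card T) = (real r + 1) ^ r - real r ^ r"
    using s(4) by (simp add: sum_diff1 r_def)
  \<comment> \<open>For r = 0 this relies on 0^0 = 1.\<close>
  have rr: "1 \<le> real r ^ r"
    by (cases "r = 0") auto
  have "\<bar>joint_cumulant m S\<bar> \<le> \<bar>m S\<bar> + \<bar>\<Sum>T\<in>Pow S' - {S'}. joint_cumulant m (insert s T) * m (S' - T)\<bar>"
    using joint_cumulant_rec[of S m] psubset by (simp add: s_def S'_def)
  also have "\<dots> \<le> b S + (\<Sum>T\<in>Pow S' - {S'}. real r ^ card T * b S)"
    by (intro add_mono psubset.prems order.refl order.trans[OF sum_abs] sum_mono *)
  also have "\<dots> = (1 + ((real r + 1) ^ r - real r ^ r)) * b S"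
    by (simp only: sum_distrib_right[symmetric] sum) (simp add: algebra_simps)
  also have "\<dots> \<le> (real r + 1) ^ r * b S"
    using rr b0[of S] by (intro mult_right_mono) auto
  finally show ?case
    using s by (simp add: add.commute)
qed

section \<open>Connected families of embeddings in strongly balanced graphs\<close>

definition embeddings :: "nat \<Rightarrow> nat \<Rightarrow> (nat \<Rightarrow> nat) set" where
  "embeddings k n = {\<beta> \<in> {1..k} \<rightarrow>\<^sub>E {1..n}. inj_on \<beta> {1..k}}"

definition union_vertices :: "nat \<Rightarrow> (nat \<Rightarrow> nat \<Rightarrow> nat) \<Rightarrow> nat set \<Rightarrow> nat set" where
  "union_vertices k \<alpha> S = (\<Union>i\<in>S. \<alpha> i ` {1..k})"

definition union_edges :: "nat set set \<Rightarrow> (nat \<Rightarrow> nat \<Rightarrow> nat) \<Rightarrow> nat set \<Rightarrow> nat set set" where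
  "union_edges E \<alpha> S = (\<Union>i\<in>S. (`) (\<alpha> i) ` E)"

lemma finite_embeddings: "finite (embeddings k n)"
  unfolding embeddings_def by (rule finite_subset[OF _ finite_PiE[of "{1..k}" "\<lambda>_. {1..n}"]]) auto

lemma card_embeddings: "card (embeddings k n) = (\<Prod>i\<in>{0..<k}. n - i)"
  unfolding embeddings_def using card_inj_on_subset_funcset[of "{1..k}" "{1..n}" "{1..k}"] by simp

text \<open>Each of the k factors n - i, with i < k <= n/2, is at least n/2.\<close>

lemma card_embeddings_ge:
  assumes "n \<ge> 2 * k"
  shows "real (card (embeddings k n)) \<ge> (real n / 2) ^ k"
proof -
  have "(\<Prod>i\<in>{0..<k}. real n / 2) \<le> (\<Prod>i\<in>{0..<k}. real (n - i))"
    using assms by (intro prod_mono) (auto simp: of_nat_diff)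
  then show ?thesis by (simp add: card_embeddings)
qed

lemma inj_on_image_edges:
  assumes "simple_graph V E" "inj_on \<beta> V"
  shows "inj_on ((`) \<beta>) E"
  using assms unfolding simple_graph_def
  by (intro inj_on_subset[OF inj_on_image_Pow[OF assms(2)]]) auto

lemma finite_edges: "simple_graph V E \<Longrightarrow> finite E"
  unfolding simple_graph_def by (rule finite_subset[of _ "Pow V"]) auto

text \<open>Strong balance without division, for induced subgraphs. It extends to a single vertex,
  where the quotient is excluded but both sides vanish.\<close>

lemma strongly_balanced_induced:
  assumes "simple_graph {1..k} E" "strongly_balanced {1..k} E" "k \<ge> 2" "W \<subseteq> {1..k}" "W \<noteq> {}"
  shows "real (card {e \<in> E. e \<subseteq> W}) * (real k - 1) \<le> (real (card W) - 1) * real (card E)"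
proof (cases "card W \<ge> 2")
  case True
  have "simple_graph W {e \<in> E. e \<subseteq> W}"
    using assms finite_subset[OF assms(4)] by (auto simp: simple_graph_def)
  then have "real (card {e \<in> E. e \<subseteq> W}) / (real (card W) - 1) \<le> real (card E) / (real (card {1..k}) - 1)"
    by (intro assms(2)[unfolded strongly_balanced_def, rule_format]) (use assms(4) True in auto)
  then show ?thesis
    using True assms(3) by (simp add: field_simps)
next
  case False
  have "finite W"
    using assms(4) finite_subset by blast
  then have W: "card W = 1"
    using False assms(5) card_gt_0_iff[of W] by linarith
  have "\<not> e \<subseteq> W" if "e \<in> E" for e
  proof
    assume "e \<subseteq> W"
    then have "card e \<le> 1"
      using card_mono[OF \<open>finite W\<close>] W by auto
    then show False
      using assms(1) that by (auto simp: simple_graph_def)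
  qed
  then have empty: "{e \<in> E. e \<subseteq> W} = {}"
    by blast
  show ?thesis
    unfolding empty W by simp
qed

text \<open>Let W0 be the set of vertices of G sent into W by the new copy. The copy adds k - |W0|
  vertices and at least e(G) - e(W0) edges, because an edge not inside W0 has an image not inside W,
  hence not in F. The inequality persists if e(W0) (k - 1) <= (|W0| - 1) e(G), which is strong
  balance for the subgraph induced on W0.\<close>

lemma union_step:
  assumes "simple_graph {1..k} E" "strongly_balanced {1..k} E" "k \<ge> 2"
    and "inj_on \<beta> {1..k}" "finite W" "\<beta> ` {1..k} \<inter> W \<noteq> {}"
    and "finite F" "\<And>e. e \<in> F \<Longrightarrow> e \<subseteq> W"
    and F: "(real (card W) - 1) * real (card E) \<le> real (card F) * (real k - 1)"
  shows "(real (card (W \<union> \<beta> ` {1..k})) - 1) * real (card E) \<le> real (card (F \<union> (`) \<beta> ` E)) * (real k - 1)"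
    and "card (W \<union> \<beta> ` {1..k}) \<le> card W + (k - 1)"
proof -
  define W0 where "W0 = {v \<in> {1..k}. \<beta> v \<in> W}"
  have W0: "W0 \<subseteq> {1..k}" "W0 \<noteq> {}" "finite W0"
    using assms(6) by (auto simp: W0_def)
  have cW0: "card W0 \<le> k" "card W0 \<ge> 1"
    using W0 card_mono[OF _ W0(1)] card_gt_0_iff[of W0] by auto
  have fE: "finite E"
    using assms(1) by (rule finite_edges)
  have "W \<union> \<beta> ` {1..k} = W \<union> \<beta> ` ({1..k} - W0)" "W \<inter> \<beta> ` ({1..k} - W0) = {}"
    by (auto simp: W0_def)
  moreover have "card (\<beta> ` ({1..k} - W0)) = k - card W0"
    using card_image[OF inj_on_subset[OF assms(4), of "{1..k} - W0"]] card_Diff_subset[OF W0(3,1)] by auto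
  ultimately have cW: "card (W \<union> \<beta> ` {1..k}) = card W + (k - card W0)"
    using card_Un_disjoint[OF assms(5), of "\<beta> ` ({1..k} - W0)"] by auto
  then show "card (W \<union> \<beta> ` {1..k}) \<le> card W + (k - 1)"
    using cW0 by simp
  have "F \<union> (`) \<beta> ` (E - {e \<in> E. e \<subseteq> W0}) \<subseteq> F \<union> (`) \<beta> ` E"
    by auto
  then have "card (F \<union> (`) \<beta> ` (E - {e \<in> E. e \<subseteq> W0})) \<le> card (F \<union> (`) \<beta> ` E)"
    using assms(7) fE by (intro card_mono) auto
  moreover have "F \<inter> (`) \<beta> ` (E - {e \<in> E. e \<subseteq> W0}) = {}"
    using assms(1,8) by (force simp: simple_graph_def W0_def)
  moreover have "card ((`) \<beta> ` (E - {e \<in> E. e \<subseteq> W0})) = card E - card {e \<in> E. e \<subseteq> W0}"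
    using inj_on_subset[OF inj_on_image_edges[OF assms(1,4)]] fE
    by (subst card_image) (auto simp: card_Diff_subset)
  moreover have "card {e \<in> E. e \<subseteq> W0} \<le> card E"
    using fE by (intro card_mono) auto
  ultimately have cF: "real (card F) + real (card E) - real (card {e \<in> E. e \<subseteq> W0}) \<le> real (card (F \<union> (`) \<beta> ` E))"
    using assms(7) fE by (simp add: card_Un_disjoint)
  have "(real (card W) + (real k - real (card W0)) - 1) * real (card E)
      \<le> (real (card F) + real (card E) - real (card {e \<in> E. e \<subseteq> W0})) * (real k - 1)"
    using F strongly_balanced_induced[OF assms(1-3) W0(1,2)] by (simp add: algebra_simps)
  also have "\<dots> \<le> real (card (F \<union> (`) \<beta> ` E)) * (real k - 1)"
    using cF assms(3) by (intro mult_right_mono) auto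
  finally show "(real (card (W \<union> \<beta> ` {1..k})) - 1) * real (card E) \<le> real (card (F \<union> (`) \<beta> ` E)) * (real k - 1)"
    unfolding cW using cW0 by (simp add: of_nat_diff add_diff_eq)
qed

lemma finite_union_vertices: "finite S \<Longrightarrow> finite (union_vertices k \<alpha> S)"
  by (simp add: union_vertices_def)

lemma finite_union_edges: "finite S \<Longrightarrow> finite E \<Longrightarrow> finite (union_edges E \<alpha> S)"
  by (simp add: union_edges_def)

lemma union_edges_subset_union_vertices:
  "simple_graph {1..k} E \<Longrightarrow> e \<in> union_edges E \<alpha> S \<Longrightarrow> e \<subseteq> union_vertices k \<alpha> S"
  unfolding union_edges_def union_vertices_def simple_graph_def by blast

text \<open>Connectedness of the intersection graph of the copies, expressed through cuts: a failing
  cut is a splitting into vertex-disjoint subfamilies, and a valid cut supplies a next copy that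
  touches those already chosen.\<close>

definition connected_family :: "nat \<Rightarrow> (nat \<Rightarrow> nat \<Rightarrow> nat) \<Rightarrow> nat set \<Rightarrow> bool" where
  "connected_family k \<alpha> S \<longleftrightarrow>
     (\<forall>T. T \<noteq> {} \<and> T \<subset> S \<longrightarrow> union_vertices k \<alpha> T \<inter> union_vertices k \<alpha> (S - T) \<noteq> {})"

lemma connected_family_bounds:
  assumes G: "simple_graph {1..k} E" "strongly_balanced {1..k} E" "k \<ge> 2"
    and S: "finite S" "S \<noteq> {}" and inj: "\<And>i. i \<in> S \<Longrightarrow> inj_on (\<alpha> i) {1..k}"
    and conn: "connected_family k \<alpha> S"
  shows "(real (card (union_vertices k \<alpha> S)) - 1) * real (card E)
      \<le> real (card (union_edges E \<alpha> S)) * (real k - 1)"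
    and "card (union_vertices k \<alpha> S) \<le> card S * (k - 1) + 1"
proof -
  define P where "P T \<longleftrightarrow> T \<noteq> {} \<and> T \<subseteq> S \<and>
    (real (card (union_vertices k \<alpha> T)) - 1) * real (card E)
      \<le> real (card (union_edges E \<alpha> T)) * (real k - 1) \<and>
    card (union_vertices k \<alpha> T) \<le> card T * (k - 1) + 1" for T
  have fE: "finite E"
    using G(1) by (rule finite_edges)
  \<comment> \<open>Grow a subfamily one copy at a time, always by a copy that meets the vertices
    already covered. A single copy satisfies both bounds with equality.\<close>
  have "\<exists>T. P T \<and> card T = m" if "1 \<le> m" "m \<le> card S" for m
    using that
  proof (induction m rule: dec_induct)
    case base
    obtain s where s: "s \<in> S" using S by blast
    have "card (union_vertices k \<alpha> {s}) = k" "card (union_edges E \<alpha> {s}) = card E"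
      using inj[OF s] inj_on_image_edges[OF G(1) inj[OF s]]
      by (simp_all add: union_vertices_def union_edges_def card_image)
    then have "P {s}"
      using s G(3) by (simp add: P_def mult.commute)
    then show ?case
      by (intro exI[of _ "{s}"]) simp
  next
    case (step m)
    then obtain T where T: "P T" "card T = m" by auto
    have "T \<subset> S" "T \<noteq> {}" "finite T"
      using T step S finite_subset[of T S] by (auto simp: P_def)
    then have "union_vertices k \<alpha> T \<inter> union_vertices k \<alpha> (S - T) \<noteq> {}"
      using conn unfolding connected_family_def by blast
    then obtain i where i: "i \<in> S" "i \<notin> T" "\<alpha> i ` {1..k} \<inter> union_vertices k \<alpha> T \<noteq> {}"
      by (auto simp: union_vertices_def)
    have eq: "union_vertices k \<alpha> (insert i T) = union_vertices k \<alpha> T \<union> \<alpha> i ` {1..k}"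
        "union_edges E \<alpha> (insert i T) = union_edges E \<alpha> T \<union> (`) (\<alpha> i) ` E"
      by (auto simp: union_vertices_def union_edges_def)
    note st = union_step[OF G inj[OF i(1)] finite_union_vertices[OF \<open>finite T\<close>] i(3)
        finite_union_edges[OF \<open>finite T\<close> fE] union_edges_subset_union_vertices[OF G(1)]]
    have "P (insert i T)"
      using T st i \<open>finite T\<close> by (auto simp: P_def eq)
    then show ?case
      using T i \<open>finite T\<close> by (intro exI[of _ "insert i T"]) simp
  qed
  from this[of "card S"] obtain T where "P T" "card T = card S"
    using S card_gt_0_iff[of S] by auto
  moreover from this have "T = S"
    using S card_subset_eq by (auto simp: P_def)
  ultimately show "(real (card (union_vertices k \<alpha> S)) - 1) * real (card E)
      \<le> real (card (union_edges E \<alpha> S)) * (real k - 1)"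
    and "card (union_vertices k \<alpha> S) \<le> card S * (k - 1) + 1"
    by (auto simp: P_def)
qed

text \<open>Choose the covered set W in at most n^v ways, then each of the k values of every copy in
  v ways; injectivity and the requirement that all of W be covered are dropped.\<close>

lemma card_families_le:
  assumes S: "finite S"
  shows "card {\<alpha> \<in> S \<rightarrow>\<^sub>E embeddings k n. card (union_vertices k \<alpha> S) = v} \<le> n ^ v * v ^ (k * card S)"
proof -
  let ?C = "{W. W \<subseteq> {1..n} \<and> card W = v}"
  let ?D = "\<lambda>W. S \<rightarrow>\<^sub>E ({1..k} \<rightarrow>\<^sub>E W)"
  have "{\<alpha> \<in> S \<rightarrow>\<^sub>E embeddings k n. card (union_vertices k \<alpha> S) = v} \<subseteq> (\<Union>W\<in>?C. ?D W)"
  proof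
    fix \<alpha> assume \<alpha>: "\<alpha> \<in> {\<alpha> \<in> S \<rightarrow>\<^sub>E embeddings k n. card (union_vertices k \<alpha> S) = v}"
    then have mem: "\<alpha> i \<in> {1..k} \<rightarrow>\<^sub>E {1..n}" if "i \<in> S" for i
      using that by (auto simp: embeddings_def)
    then have "union_vertices k \<alpha> S \<subseteq> {1..n}"
      by (force simp: union_vertices_def PiE_iff)
    moreover have "\<alpha> \<in> ?D (union_vertices k \<alpha> S)"
    proof (rule PiE_I)
      fix i assume "i \<in> S"
      then show "\<alpha> i \<in> {1..k} \<rightarrow>\<^sub>E union_vertices k \<alpha> S"
        using mem[of i] by (auto simp: union_vertices_def PiE_iff)
    qed (use \<alpha> in auto)
    ultimately show "\<alpha> \<in> (\<Union>W\<in>?C. ?D W)"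
      using \<alpha> by blast
  qed
  moreover have fin: "finite ?C" "\<And>W. W \<in> ?C \<Longrightarrow> finite W"
    by (auto intro: finite_subset[OF _ finite_atLeastAtMost])
  moreover have "finite (\<Union>W\<in>?C. ?D W)"
    by (intro finite_UN_I[OF fin(1)] finite_PiE S finite_atLeastAtMost) (rule fin(2))
  ultimately have "card {\<alpha> \<in> S \<rightarrow>\<^sub>E embeddings k n. card (union_vertices k \<alpha> S) = v} \<le> card (\<Union>W\<in>?C. ?D W)"
    by (intro card_mono)
  also have "\<dots> \<le> (\<Sum>W\<in>?C. card (?D W))"
    using fin(1) by (rule card_UN_le)
  also have "\<dots> = (\<Sum>W\<in>?C. v ^ (k * card S))"
    using S by (intro sum.cong refl) (auto simp: card_funcsetE power_mult)
  also have "\<dots> = (n choose v) * v ^ (k * card S)"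
    using n_subsets[of "{1..n}" v] by simp
  also have "\<dots> \<le> n ^ v * v ^ (k * card S)"
    by (cases "v \<le> n") (auto simp: binomial_le_pow binomial_eq_0)
  finally show ?thesis .
qed

text \<open>Families are grouped by the number v of covered vertices. B dominates n^v q^(v-1) over
  the possible v and stays a parameter because its value depends on the regime; L will be the factor
  j^(j-1) of the joint cumulant bound.\<close>

lemma sum_families_le:
  fixes c :: "(nat \<Rightarrow> nat \<Rightarrow> nat) \<Rightarrow> real" and p q B L :: real
  assumes G: "simple_graph {1..k} E" "strongly_balanced {1..k} E" "k \<ge> 2"
    and S: "finite S" "S \<noteq> {}" and p: "0 < p" "p < 1" and "0 \<le> L"
    and conn: "\<And>\<alpha>. \<alpha> \<in> S \<rightarrow>\<^sub>E embeddings k n \<Longrightarrow> connected_family k \<alpha> S \<Longrightarrow> c \<alpha> \<le> L * p ^ card (union_edges E \<alpha> S)"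
    and disconn: "\<And>\<alpha>. \<alpha> \<in> S \<rightarrow>\<^sub>E embeddings k n \<Longrightarrow> \<not> connected_family k \<alpha> S \<Longrightarrow> c \<alpha> \<le> 0"
    and q: "q = p powr (real (card E) / (real k - 1))"
    and B: "\<And>v. k \<le> v \<Longrightarrow> v \<le> card S * (k - 1) + 1 \<Longrightarrow> real n ^ v * q ^ (v - 1) \<le> B"
  shows "(\<Sum>\<alpha>\<in>S \<rightarrow>\<^sub>E embeddings k n. c \<alpha>) \<le> L * real (card S * k) ^ (k * card S + 1) * B"
proof -
  define j where "j = card S"
  have j: "j \<ge> 1"
    using S card_gt_0_iff[of S] by (simp add: j_def)
  let ?A = "S \<rightarrow>\<^sub>E embeddings k n"
  let ?V = "\<lambda>\<alpha>. card (union_vertices k \<alpha> S)"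
  let ?R = "{k..j * (k - 1) + 1}"
  have finA: "finite ?A"
    using S finite_embeddings by (intro finite_PiE) auto
  \<comment> \<open>Nonnegativity of B follows from the admissible value v = k.\<close>
  have B0: "0 \<le> B"
  proof -
    have "0 \<le> real n ^ k * q ^ (k - 1)" using q by simp
    also have "\<dots> \<le> B"
    proof (rule B)
      have "1 * (k - 1) \<le> j * (k - 1)" using j by (intro mult_right_mono) auto
      then show "k \<le> card S * (k - 1) + 1" using G(3) unfolding j_def by linarith
    qed simp
    finally show ?thesis .
  qed
  have c_le: "c \<alpha> \<le> (if ?V \<alpha> \<in> ?R then L * q ^ (?V \<alpha> - 1) else 0)" if \<alpha>: "\<alpha> \<in> ?A" for \<alpha>
  proof (cases "connected_family k \<alpha> S")
    case True
    have inj: "inj_on (\<alpha> i) {1..k}" if "i \<in> S" for i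
      using \<alpha> that by (auto simp: embeddings_def PiE_iff)
    note b = connected_family_bounds[OF G S inj True]
    obtain s where s: "s \<in> S" using S by blast
    have "card (\<alpha> s ` {1..k}) \<le> ?V \<alpha>"
      using s S by (intro card_mono finite_union_vertices) (auto simp: union_vertices_def)
    then have R: "?V \<alpha> \<in> ?R"
      using b(2) inj[OF s] by (simp add: card_image j_def)
    have V1: "real (?V \<alpha>) - 1 = real (?V \<alpha> - 1)"
      using R G(3) by (subst of_nat_diff) auto
    have "p ^ card (union_edges E \<alpha> S) = p powr real (card (union_edges E \<alpha> S))"
      using p by (simp add: powr_realpow)
    \<comment> \<open>As p < 1, the lower bound on the number of edges becomes an upper bound on the
      power of p.\<close>
    also have "\<dots> \<le> p powr (real (card E) / (real k - 1) * real (?V \<alpha> - 1))"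
      using b(1) G(3) p by (intro powr_mono') (auto simp: field_simps V1)
    also have "\<dots> = q ^ (?V \<alpha> - 1)"
      using p by (subst powr_powr[symmetric], subst powr_realpow) (auto simp: q)
    finally have "L * p ^ card (union_edges E \<alpha> S) \<le> L * q ^ (?V \<alpha> - 1)"
      using \<open>0 \<le> L\<close> by (rule mult_left_mono)
    then show ?thesis
      using conn[OF \<alpha> True] R by auto
  next
    case False
    moreover have "0 \<le> L * q ^ (?V \<alpha> - 1)"
      using \<open>0 \<le> L\<close> q by simp
    ultimately show ?thesis
      using disconn[OF \<alpha> False] by auto
  qed
  have "(\<Sum>\<alpha>\<in>?A. c \<alpha>) \<le> (\<Sum>\<alpha>\<in>?A. if ?V \<alpha> \<in> ?R then L * q ^ (?V \<alpha> - 1) else 0)"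
    by (intro sum_mono c_le)
  also have "\<dots> = (\<Sum>\<alpha>\<in>?A. \<Sum>v\<in>?R. if ?V \<alpha> = v then L * q ^ (v - 1) else 0)"
    by (intro sum.cong refl) (simp add: sum.delta)
  also have "\<dots> = (\<Sum>v\<in>?R. \<Sum>\<alpha>\<in>?A. if ?V \<alpha> = v then L * q ^ (v - 1) else 0)"
    by (rule sum.swap)
  also have "\<dots> = (\<Sum>v\<in>?R. real (card {\<alpha> \<in> ?A. ?V \<alpha> = v}) * (L * q ^ (v - 1)))"
    using finA by (intro sum.cong refl) (simp add: sum.If_cases Int_def)
  also have "\<dots> \<le> (\<Sum>v\<in>?R. L * real (j * k) ^ (k * j) * B)"
  proof (rule sum_mono)
    fix v assume v: "v \<in> ?R"
    have "j * (k - 1) + 1 \<le> j * (k - 1) + j" using j by simp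
    also have "\<dots> = j * k" using G(3) by (cases k) auto
    finally have vjk: "v \<le> j * k" using v by simp
    have "real (card {\<alpha> \<in> ?A. ?V \<alpha> = v}) \<le> real (n ^ v * v ^ (k * j))"
      unfolding j_def by (intro of_nat_mono card_families_le S)
    also have "\<dots> \<le> real (n ^ v * (j * k) ^ (k * j))"
      using vjk by (intro of_nat_mono mult_left_mono power_mono) auto
    also have "\<dots> = real n ^ v * real (j * k) ^ (k * j)"
      by simp
    finally have "real (card {\<alpha> \<in> ?A. ?V \<alpha> = v}) * (L * q ^ (v - 1)) \<le> real n ^ v * real (j * k) ^ (k * j) * (L * q ^ (v - 1))"
      using \<open>0 \<le> L\<close> q by (intro mult_right_mono) auto
    also have "\<dots> = L * real (j * k) ^ (k * j) * (real n ^ v * q ^ (v - 1))"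
      by simp
    also have "\<dots> \<le> L * real (j * k) ^ (k * j) * B"
      using B v \<open>0 \<le> L\<close> by (intro mult_left_mono) (auto simp: j_def)
    finally show "real (card {\<alpha> \<in> ?A. ?V \<alpha> = v}) * (L * q ^ (v - 1)) \<le> L * real (j * k) ^ (k * j) * B" .
  qed
  also have "\<dots> = real (card ?R) * (L * real (j * k) ^ (k * j) * B)"
    by simp
  \<comment> \<open>At most j k values of v occur; this accounts for the last unit in the exponent k
    j + 1.\<close>
  also have "\<dots> \<le> real (j * k) * (L * real (j * k) ^ (k * j) * B)"
  proof (intro mult_right_mono of_nat_mono)
    have "j * (k - 1) \<le> j * k" by simp
    then show "card ?R \<le> j * k"
      unfolding card_atLeastAtMost using G(3) by linarith
  qed (use \<open>0 \<le> L\<close> B0 in auto)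
  finally show ?thesis
    by (simp add: j_def mult_ac)
qed

section \<open>Integrals over independent points\<close>

text \<open>It quantifies over all functions, not only over the extensional ones of the product
  space, so that it applies directly to \<open>merge\<close>, \<open>fun_upd\<close> and
  restrictions.\<close>

definition depends_on :: "'i set \<Rightarrow> (('i \<Rightarrow> 'a) \<Rightarrow> 'b) \<Rightarrow> bool" where
  "depends_on A f \<longleftrightarrow> (\<forall>x y. (\<forall>i\<in>A. x i = y i) \<longrightarrow> f x = f y)"

lemma depends_onD: "depends_on A f \<Longrightarrow> (\<And>i. i \<in> A \<Longrightarrow> x i = y i) \<Longrightarrow> f x = f y"
  by (auto simp: depends_on_def)

lemma card_2_Min_Max:
  fixes e :: "nat set"
  assumes "card e = 2"
  obtains a b where "e = {a, b}" "a < b" "Min e = a" "Max e = b"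
proof -
  obtain x y where "e = {x, y}" "x \<noteq> y"
    using assms by (auto simp: card_2_iff)
  then show thesis
    using that[of x y] that[of y x] by (cases "x < y") (auto simp: insert_commute)
qed

text \<open>Multiplied by p^|T|, this is the conditional probability, given the points, that all
  edges of T are present.\<close>

definition edges_weight :: "('a \<Rightarrow> 'a \<Rightarrow> real) \<Rightarrow> nat set set \<Rightarrow> (nat \<Rightarrow> 'a) \<Rightarrow> real" where
  "edges_weight H T x = (\<Prod>e\<in>T. edge_weight H x e)"

lemma depends_on_edges_weight:
  assumes "\<And>e. e \<in> T \<Longrightarrow> e \<subseteq> V \<and> card e = 2"
  shows "depends_on V (edges_weight H T)"
  unfolding depends_on_def edges_weight_def
proof (intro allI impI prod.cong refl)
  fix x y :: "nat \<Rightarrow> 'a" and e assume xy: "\<forall>i\<in>V. x i = y i" and e: "e \<in> T"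
  then show "edge_weight H x e = edge_weight H y e"
    using assms[OF e] by (auto elim!: card_2_Min_Max simp: edge_weight_def)
qed

locale connection_kernel = prob_space \<mu> for \<mu> :: "'a::euclidean_space measure" +
  fixes H :: "'a \<Rightarrow> 'a \<Rightarrow> real"
  assumes sets_mu: "sets \<mu> = sets borel"
    and H_measurable: "(\<lambda>(x, y). H x y) \<in> borel_measurable (borel \<Otimes>\<^sub>M borel)"
    and H_symmetric: "\<And>x y. H x y = H y x"
    and H_range: "\<And>x y. 0 \<le> H x y \<and> H x y \<le> 1"
begin

sublocale product: product_prob_space "\<lambda>_. \<mu>" "UNIV :: nat set"
  by unfold_locales

abbreviation points :: "nat set \<Rightarrow> (nat \<Rightarrow> 'a) measure" where
  "points I \<equiv> Pi\<^sub>M I (\<lambda>_. \<mu>)"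

lemma prob_space_points: "prob_space (points I)"
  by (intro prob_space_PiM) (rule prob_space_axioms)

lemma edges_weight_range: "0 \<le> edges_weight H T x" "edges_weight H T x \<le> 1"
  using H_range by (auto simp: edges_weight_def edge_weight_def intro!: prod_nonneg prod_le_1)

lemma edges_weight_measurable:
  assumes "\<And>e. e \<in> T \<Longrightarrow> e \<subseteq> I \<and> card e = 2"
  shows "edges_weight H T \<in> borel_measurable (points I)"
  unfolding edges_weight_def[abs_def] edge_weight_def
proof (rule borel_measurable_prod)
  fix e assume "e \<in> T"
  then have "Min e \<in> I" "Max e \<in> I"
    using assms[of e] by (auto elim!: card_2_Min_Max)
  then have "(\<lambda>x. (x (Min e), x (Max e))) \<in> points I \<rightarrow>\<^sub>M \<mu> \<Otimes>\<^sub>M \<mu>"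
    by (intro measurable_Pair measurable_component_singleton)
  moreover have "(\<lambda>(x, y). H x y) \<in> borel_measurable (\<mu> \<Otimes>\<^sub>M \<mu>)"
    using H_measurable measurable_cong_sets[OF sets_pair_measure_cong[OF sets_mu sets_mu] refl] by blast
  ultimately show "(\<lambda>x. H (x (Min e)) (x (Max e))) \<in> borel_measurable (points I)"
    using measurable_compose by fastforce
qed

text \<open>\<beta> may reverse the order of the endpoints and so exchange \<open>Min\<close> and
  \<open>Max\<close>; symmetry of H absorbs this.\<close>

lemma edge_weight_image:
  assumes "card e = 2" "inj_on \<beta> e"
  shows "edge_weight H x (\<beta> ` e) = edge_weight H (\<lambda>i. x (\<beta> i)) e"
proof -
  obtain a b where e: "e = {a, b}" "a < b" "Min e = a" "Max e = b"
    using card_2_Min_Max[OF assms(1)] .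
  then have "\<beta> a \<noteq> \<beta> b"
    using assms(2) by (auto simp: inj_on_def)
  then show ?thesis
    using e H_symmetric by (cases "\<beta> a < \<beta> b") (auto simp: edge_weight_def)
qed

lemma integrable_bounded_points:
  assumes "f \<in> borel_measurable (points I)" "\<And>x. \<bar>f x\<bar> \<le> (B::real)"
  shows "integrable (points I) f"
proof -
  interpret I: prob_space "points I" by (rule prob_space_points)
  show ?thesis
    using assms by (intro I.integrable_const_bound[of _ B]) auto
qed

lemma integral_points_reindex:
  fixes g :: "(nat \<Rightarrow> 'a) \<Rightarrow> real"
  assumes "inj_on f I" "f \<in> I \<rightarrow> K" "g \<in> borel_measurable (points I)"
  shows "(\<integral>x. g (\<lambda>i\<in>I. x (f i)) \<partial>points K) = (\<integral>x. g x \<partial>points I)"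
proof -
  have meas: "(\<lambda>x. \<lambda>i\<in>I. x (f i)) \<in> points K \<rightarrow>\<^sub>M points I"
    using assms(2) by (intro measurable_restrict measurable_component_singleton) auto
  have "distr (points K) (points I) (\<lambda>x. \<lambda>i\<in>I. x (f i)) = points I"
    by (rule distr_PiM_reindex[OF prob_space_axioms assms(1,2)])
  then show ?thesis
    using integral_distr[OF meas assms(3)] by simp
qed

text \<open>Independence of functions of disjoint groups of points, by folding the product measure
  over A and its complement.\<close>

lemma integral_points_factor:
  fixes f g :: "(nat \<Rightarrow> 'a) \<Rightarrow> real"
  assumes I: "finite I" "A \<subseteq> I"
    and f: "f \<in> borel_measurable (points I)" "depends_on A f" "\<And>x. \<bar>f x\<bar> \<le> B"
    and g: "g \<in> borel_measurable (points I)" "depends_on (I - A) g" "\<And>x. \<bar>g x\<bar> \<le> B"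
  shows "(\<integral>x. f x * g x \<partial>points I) = (\<integral>x. f x \<partial>points I) * (\<integral>x. g x \<partial>points I)"
proof -
  have A: "A \<union> (I - A) = I" "finite A" "finite (I - A)" "A \<inter> (I - A) = {}"
    using I finite_subset by auto
  have split: "(\<integral>x. u x * v x \<partial>points I) = (\<integral>x. u x \<partial>points A) * (\<integral>x. v x \<partial>points (I - A))"
    if u: "u \<in> borel_measurable (points I)" "depends_on A u" "\<And>x. \<bar>u x\<bar> \<le> b"
      and v: "v \<in> borel_measurable (points I)" "depends_on (I - A) v" "\<And>x. \<bar>v x\<bar> \<le> b"
    for u v :: "(nat \<Rightarrow> 'a) \<Rightarrow> real" and b
  proof -
    have "\<bar>u x * v x\<bar> \<le> b * b" for x
      unfolding abs_mult using u(3)[of x] v(3)[of x] by (intro mult_mono) auto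
    then have "integrable (points I) (\<lambda>x. u x * v x)"
      using u v by (intro integrable_bounded_points) auto
    then have "(\<integral>x. u x * v x \<partial>points I) =
        (\<integral>x. (\<integral>y. u (merge A (I - A) (x, y)) * v (merge A (I - A) (x, y)) \<partial>points (I - A)) \<partial>points A)"
      using product.product_integral_fold[OF A(4,2,3), of "\<lambda>x. u x * v x"] unfolding A(1) by blast
    also have "\<dots> = (\<integral>x. (\<integral>y. u x * v y \<partial>points (I - A)) \<partial>points A)"
    proof (intro Bochner_Integration.integral_cong refl arg_cong2[of _ _ _ _ "(*)"])
      show "u (merge A (I - A) (x, y)) = u x" for x y
        by (rule depends_onD[OF u(2)]) (simp add: merge_def)
      show "v (merge A (I - A) (x, y)) = v y" for x y
        by (rule depends_onD[OF v(2)]) (simp add: merge_def)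
    qed
    finally show ?thesis by simp
  qed
  interpret A: prob_space "points A" by (rule prob_space_points)
  interpret B: prob_space "points (I - A)" by (rule prob_space_points)
  \<comment> \<open>Splitting with the other factor equal to 1 identifies each integral with one
    over its own coordinates; \<open>max 1 B\<close> bounds both factors.\<close>
  have "(\<integral>x. f x \<partial>points I) = (\<integral>x. f x \<partial>points A)"
    using split[of f "max 1 B" "\<lambda>_. 1"] f by (fastforce simp: depends_on_def le_max_iff_disj A.prob_space B.prob_space)
  moreover have "(\<integral>x. g x \<partial>points I) = (\<integral>x. g x \<partial>points (I - A))"
    using split[of "\<lambda>_. 1" "max 1 B" g] g by (fastforce simp: depends_on_def le_max_iff_disj A.prob_space B.prob_space)
  ultimately show ?thesis
    using split[OF f g] by simp
qed

lemma component_measurable: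
  fixes g :: "'a \<Rightarrow> real"
  assumes "i \<in> I" "g \<in> borel_measurable \<mu>"
  shows "(\<lambda>x. g (x i)) \<in> borel_measurable (points I)"
  using measurable_compose[OF measurable_component_singleton[of i I "\<lambda>_. \<mu>", OF assms(1)] assms(2)] .

lemma integral_points_component:
  fixes g :: "'a \<Rightarrow> real"
  assumes "i \<in> I" "g \<in> borel_measurable \<mu>"
  shows "(\<integral>x. g (x i) \<partial>points I) = (\<integral>x. g x \<partial>\<mu>)"
  using distr_PiM_component[of I "\<lambda>_. \<mu>" i] prob_space_axioms assms
    integral_distr[of "\<lambda>x. x i" "points I" \<mu> g] by simp

end

section \<open>Densities of the graph under the kernel and the first-order projection\<close>

locale connection_graph = connection_kernel +
  fixes k :: nat and E :: "nat set set"
  assumes graph: "simple_graph {1..k} E"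
begin

lemma E_edges: "e \<in> E \<Longrightarrow> e \<subseteq> {1..k} \<and> card e = 2"
  using graph by (auto simp: simple_graph_def)

text \<open>The homomorphism density of G in the kernel H. Neither n nor p enters here or in the
  next definitions, so the final constant may depend on them.\<close>

definition graph_density :: real where
  "graph_density = (\<integral>x. edges_weight H E x \<partial>points {1..k})"

definition rooted :: "nat \<Rightarrow> 'a \<Rightarrow> real" where
  "rooted u x = (\<integral>y. edges_weight H E (y(u := x)) \<partial>points ({1..k} - {u}))"

text \<open>Up to the factor p^e(G) / a(G), this is the sum of the functions
  \<open>vertex_projection\<close> minus its mean: the kernel of the first-order Hoeffding
  projection, up to scaling.\<close>

definition centered :: "'a \<Rightarrow> real" where
  "centered x = (\<Sum>u=1..k. rooted u x) - real k * graph_density"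

definition projection_variance :: real where
  "projection_variance = (\<integral>x. (centered x)\<^sup>2 \<partial>\<mu>)"

lemma weight_E_measurable: "edges_weight H E \<in> borel_measurable (points {1..k})"
  by (rule edges_weight_measurable) (use E_edges in auto)

lemma graph_density_range: "0 \<le> graph_density" "graph_density \<le> 1"
proof -
  interpret P: prob_space "points {1..k}" by (rule prob_space_points)
  show "0 \<le> graph_density"
    unfolding graph_density_def using edges_weight_range by (intro integral_nonneg_AE) auto
  have "graph_density \<le> (\<integral>x. 1 \<partial>points {1..k})"
    unfolding graph_density_def using edges_weight_range
    by (intro integral_mono integrable_bounded_points[OF weight_E_measurable, of 1] P.integrable_const) auto
  then show "graph_density \<le> 1" using P.prob_space by simp
qed

lemma rooted_weight_measurable:
  assumes "u \<in> {1..k}"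
  shows "(\<lambda>(x, y). edges_weight H E (y(u := x))) \<in> borel_measurable (\<mu> \<Otimes>\<^sub>M points ({1..k} - {u}))"
proof -
  have "(\<lambda>z. (snd z)(u := fst z)) \<in> \<mu> \<Otimes>\<^sub>M points ({1..k} - {u}) \<rightarrow>\<^sub>M points (insert u ({1..k} - {u}))"
    by (rule measurable_fun_upd[of _ "{1..k} - {u}"]) auto
  moreover have "insert u ({1..k} - {u}) = {1..k}"
    using assms by auto
  ultimately show ?thesis
    using measurable_compose weight_E_measurable by (fastforce simp: case_prod_beta')
qed

lemma rooted_measurable:
  assumes "u \<in> {1..k}"
  shows "rooted u \<in> borel_measurable \<mu>"
proof -
  interpret P: prob_space "points ({1..k} - {u})" by (rule prob_space_points)
  show ?thesis
    unfolding rooted_def using rooted_weight_measurable[OF assms]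
    by (intro P.borel_measurable_lebesgue_integral) auto
qed

lemma rooted_range:
  assumes "u \<in> {1..k}"
  shows "0 \<le> rooted u x" "rooted u x \<le> 1"
proof -
  interpret P: prob_space "points ({1..k} - {u})" by (rule prob_space_points)
  show "0 \<le> rooted u x"
    unfolding rooted_def using edges_weight_range by (intro integral_nonneg_AE) auto
  have "rooted u x \<le> (\<integral>y. 1 \<partial>points ({1..k} - {u}))"
    unfolding rooted_def
  proof (rule integral_mono')
    show "integrable (points ({1..k} - {u})) (\<lambda>y. 1 :: real)" by (rule P.integrable_const)
  qed (use edges_weight_range in auto)
  then show "rooted u x \<le> 1" using P.prob_space by simp
qed

lemma integral_weight_rooted:
  assumes u: "u \<in> {1..k}" and g: "g \<in> borel_measurable \<mu>" "\<And>x. \<bar>g x\<bar> \<le> B"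
  shows "(\<integral>x. edges_weight H E x * g (x u) \<partial>points {1..k}) = (\<integral>x. rooted u x * g x \<partial>\<mu>)"
proof -
  let ?J = "{1..k} - {u}"
  have J: "{u} \<union> ?J = {1..k}" "{u} \<inter> ?J = {}"
    using u by auto
  let ?f = "\<lambda>x. edges_weight H E x * g (x u)"
  have "?f \<in> borel_measurable (points {1..k})"
    by (intro borel_measurable_times weight_E_measurable component_measurable u g(1))
  moreover have "\<bar>?f x\<bar> \<le> 1 * B" for x
    unfolding abs_mult using edges_weight_range g(2) by (intro mult_mono) auto
  ultimately have int: "integrable (points {1..k}) ?f"
    by (rule integrable_bounded_points)
  have "(\<integral>x. ?f x \<partial>points {1..k}) = (\<integral>x. (\<integral>y. ?f (merge {u} ?J (x, y)) \<partial>points ?J) \<partial>points {u})"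
    using product.product_integral_fold[OF J(2), of ?f] int unfolding J(1) by simp
  also have "\<dots> = (\<integral>x. (\<integral>y. edges_weight H E (y(u := x u)) * g (x u) \<partial>points ?J) \<partial>points {u})"
  proof (intro Bochner_Integration.integral_cong refl arg_cong2[of _ _ _ _ "(*)"])
    show "edges_weight H E (merge {u} ?J (x, y)) = edges_weight H E (y(u := x u))" for x y
    proof (rule depends_onD[OF depends_on_edges_weight])
      show "e \<in> E \<Longrightarrow> e \<subseteq> {1..k} \<and> card e = 2" for e by (rule E_edges)
    qed (auto simp: merge_def)
  qed (simp add: merge_def)
  also have "\<dots> = (\<integral>x. rooted u (x u) * g (x u) \<partial>points {u})"
    by (simp add: rooted_def)
  also have "\<dots> = (\<integral>x. rooted u x * g x \<partial>\<mu>)"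
    using rooted_measurable[OF u] g(1) by (intro product.product_integral_singleton) simp
  finally show ?thesis .
qed

lemma integral_rooted: "u \<in> {1..k} \<Longrightarrow> (\<integral>x. rooted u x \<partial>\<mu>) = graph_density"
  using integral_weight_rooted[of u "\<lambda>_. 1" 1] by (simp add: graph_density_def)

lemma integrable_rooted_mult:
  assumes "u \<in> {1..k}" "g \<in> borel_measurable \<mu>" "\<And>x. \<bar>g x\<bar> \<le> B"
  shows "integrable \<mu> (\<lambda>x. rooted u x * g x)"
proof (rule integrable_const_bound)
  have "\<bar>rooted u x * g x\<bar> \<le> 1 * B" for x
    unfolding abs_mult using rooted_range[OF assms(1)] assms(3) by (intro mult_mono) auto
  then show "AE x in \<mu>. norm (rooted u x * g x) \<le> 1 * B" by simp
qed (use rooted_measurable[OF assms(1)] assms(2) in simp)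

lemma centered_measurable: "centered \<in> borel_measurable \<mu>"
  unfolding centered_def[abs_def] using rooted_measurable by auto

lemma centered_bound: "\<bar>centered x\<bar> \<le> real k"
proof -
  have "(\<Sum>u=1..k. rooted u x) \<le> (\<Sum>u=1..k. 1)" "0 \<le> (\<Sum>u=1..k. rooted u x)"
    by (intro sum_mono sum_nonneg rooted_range; simp)+
  moreover have "0 \<le> real k * graph_density" "real k * graph_density \<le> real k * 1"
    using graph_density_range mult_left_mono[of graph_density 1 "real k"] by auto
  ultimately show ?thesis
    by (simp add: centered_def)
qed

lemma integral_centered: "(\<integral>x. centered x \<partial>\<mu>) = 0"
proof -
  have "integrable \<mu> (rooted u)" if "u \<in> {1..k}" for u
    using integrable_rooted_mult[OF that, of "\<lambda>_. 1" 1] by simp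
  then have "(\<integral>x. centered x \<partial>\<mu>) = (\<integral>x. (\<Sum>u=1..k. rooted u x) \<partial>\<mu>) - (\<integral>x. real k * graph_density \<partial>\<mu>)"
    and "(\<integral>x. (\<Sum>u=1..k. rooted u x) \<partial>\<mu>) = (\<Sum>u=1..k. \<integral>x. rooted u x \<partial>\<mu>)"
    unfolding centered_def
    by (intro Bochner_Integration.integral_diff Bochner_Integration.integral_sum
        Bochner_Integration.integrable_sum integrable_const; simp)+
  then show ?thesis
    by (simp add: integral_rooted prob_space)
qed

text \<open>\<open>centered\<close> has mean 0, so the constant k times \<open>graph_density\<close>
  may be subtracted from the sum of the rooted densities, which turns the integrand into a
  square.\<close>

lemma sum_integral_rooted_centered:
  "(\<Sum>u=1..k. \<integral>x. rooted u x * centered x \<partial>\<mu>) = projection_variance"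
proof -
  have int: "integrable \<mu> (\<lambda>x. rooted u x * centered x)" if "u \<in> {1..k}" for u
    by (rule integrable_rooted_mult[OF that centered_measurable centered_bound])
  have ic: "integrable \<mu> centered"
    using centered_bound centered_measurable by (intro integrable_const_bound[of _ "real k"]) auto
  have "(\<Sum>u=1..k. \<integral>x. rooted u x * centered x \<partial>\<mu>) = (\<integral>x. (\<Sum>u=1..k. rooted u x * centered x) \<partial>\<mu>)"
    using int by (simp add: Bochner_Integration.integral_sum)
  also have "\<dots> = (\<integral>x. (\<Sum>u=1..k. rooted u x * centered x) - real k * graph_density * centered x \<partial>\<mu>)"
    using int ic by (subst Bochner_Integration.integral_diff) (auto simp: integral_centered)
  also have "\<dots> = projection_variance"
    unfolding projection_variance_def
    by (intro Bochner_Integration.integral_cong refl)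
      (simp only: sum_distrib_right[symmetric] left_diff_distrib[symmetric] centered_def[symmetric] power2_eq_square)
  finally show ?thesis .
qed

text \<open>\<open>centered\<close> is bounded by k and the rooted densities integrate to
  \<open>graph_density\<close>. The purpose is to deduce a positive density, needed in the sparse
  regime, from a positive projection variance.\<close>

lemma projection_variance_le: "projection_variance \<le> (real k)\<^sup>2 * graph_density"
proof -
  have "(\<Sum>u=1..k. \<integral>x. rooted u x * centered x \<partial>\<mu>) \<le> (\<Sum>u=1..k. \<integral>x. rooted u x * real k \<partial>\<mu>)"
  proof (intro sum_mono integral_mono)
    fix u x assume u: "u \<in> {1..k}"
    show "integrable \<mu> (\<lambda>x. rooted u x * centered x)"
      by (rule integrable_rooted_mult[OF u centered_measurable centered_bound])
    show "integrable \<mu> (\<lambda>x. rooted u x * real k)"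
      using integrable_rooted_mult[OF u, of "\<lambda>_. real k" "real k"] by simp
    show "rooted u x * centered x \<le> rooted u x * real k"
      using rooted_range[OF u] centered_bound[of x] by (intro mult_left_mono) auto
  qed
  also have "\<dots> = (real k)\<^sup>2 * graph_density"
    by (simp add: integral_rooted power2_eq_square)
  finally show ?thesis
    by (simp only: sum_integral_rooted_centered)
qed

context
  fixes n :: nat and \<beta> :: "nat \<Rightarrow> nat"
  assumes \<beta>: "\<beta> \<in> embeddings k n"
begin

lemma \<beta>_props: "inj_on \<beta> {1..k}" "\<beta> \<in> {1..k} \<rightarrow> {1..n}"
  using \<beta> by (auto simp: embeddings_def PiE_iff)

lemma image_edges: "e \<in> (`) \<beta> ` E \<Longrightarrow> e \<subseteq> \<beta> ` {1..k} \<and> e \<subseteq> {1..n} \<and> card e = 2"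
proof (elim imageE)
  fix e' assume e: "e = \<beta> ` e'" "e' \<in> E"
  then have "card (\<beta> ` e') = card e'"
    using E_edges[of e'] \<beta>_props(1) by (intro card_image) (auto intro: inj_on_subset)
  then show "e \<subseteq> \<beta> ` {1..k} \<and> e \<subseteq> {1..n} \<and> card e = 2"
    using e E_edges[of e'] \<beta>_props(2) by auto
qed

lemma card_image_edges: "card ((`) \<beta> ` E) = card E"
  by (intro card_image inj_on_image_edges[OF graph] \<beta>_props)

lemma edges_weight_image: "edges_weight H ((`) \<beta> ` E) x = edges_weight H E (\<lambda>i\<in>{1..k}. x (\<beta> i))"
proof -
  have "edges_weight H ((`) \<beta> ` E) x = (\<Prod>e\<in>E. edge_weight H x (\<beta> ` e))"
    unfolding edges_weight_def by (subst prod.reindex[OF inj_on_image_edges[OF graph \<beta>_props(1)]]) simp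
  also have "\<dots> = edges_weight H E (\<lambda>i. x (\<beta> i))"
    unfolding edges_weight_def
    using E_edges inj_on_subset[OF \<beta>_props(1)] by (intro prod.cong edge_weight_image) auto
  also have "\<dots> = edges_weight H E (\<lambda>i\<in>{1..k}. x (\<beta> i))"
    using E_edges by (intro depends_onD[OF depends_on_edges_weight[of E "{1..k}"]]) auto
  finally show ?thesis .
qed

lemma integral_image_weight: "(\<integral>x. edges_weight H ((`) \<beta> ` E) x \<partial>points {1..n}) = graph_density"
  unfolding edges_weight_image graph_density_def
  by (rule integral_points_reindex[OF \<beta>_props weight_E_measurable])

lemma integral_image_weight_component:
  assumes "u \<in> {1..k}" "g \<in> borel_measurable \<mu>" "\<And>x. \<bar>g x\<bar> \<le> B"
  shows "(\<integral>x. edges_weight H ((`) \<beta> ` E) x * g (x (\<beta> u)) \<partial>points {1..n}) = (\<integral>x. rooted u x * g x \<partial>\<mu>)"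
proof -
  have "(\<lambda>x. edges_weight H E x * g (x u)) \<in> borel_measurable (points {1..k})"
    by (intro borel_measurable_times weight_E_measurable component_measurable assms)
  from integral_points_reindex[OF \<beta>_props this] show ?thesis
    using assms(1) integral_weight_rooted[OF assms] by (simp add: edges_weight_image)
qed

text \<open>Points outside the image of \<beta> are independent of the copy and centred, hence
  contribute 0; the k points in the image give the rooted integrals, whose sum does not depend on
  \<beta>.\<close>

lemma integral_image_weight_centered:
  "(\<integral>x. edges_weight H ((`) \<beta> ` E) x * (\<Sum>i=1..n. centered (x i)) \<partial>points {1..n}) = projection_variance"
proof -
  let ?w = "edges_weight H ((`) \<beta> ` E)"
  have w: "?w \<in> borel_measurable (points {1..n})"
    using image_edges by (intro edges_weight_measurable) blast
  have c: "(\<lambda>x. centered (x i)) \<in> borel_measurable (points {1..n})" if "i \<in> {1..n}" for i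
    by (rule component_measurable[OF that centered_measurable])
  have int: "integrable (points {1..n}) (\<lambda>x. ?w x * centered (x i))" if "i \<in> {1..n}" for i
  proof (rule integrable_bounded_points)
    show "\<bar>?w x * centered (x i)\<bar> \<le> 1 * real k" for x
      unfolding abs_mult using edges_weight_range centered_bound by (intro mult_mono) auto
  qed (use w c[OF that] in simp)
  have zero: "(\<integral>x. ?w x * centered (x i) \<partial>points {1..n}) = 0" if i: "i \<in> {1..n} - \<beta> ` {1..k}" for i
  proof -
    have "(\<integral>x. ?w x * centered (x i) \<partial>points {1..n}) =
        (\<integral>x. ?w x \<partial>points {1..n}) * (\<integral>x. centered (x i) \<partial>points {1..n})"
    proof (rule integral_points_factor)
      show "depends_on (\<beta> ` {1..k}) ?w"
        using image_edges by (intro depends_on_edges_weight) blast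
      show "depends_on ({1..n} - \<beta> ` {1..k}) (\<lambda>x. centered (x i))"
        using i by (auto simp: depends_on_def)
      show "\<bar>?w x\<bar> \<le> max 1 (real k)" "\<bar>centered (x i)\<bar> \<le> max 1 (real k)" for x
        using edges_weight_range[of _ x] centered_bound[of "x i"] by (auto simp: le_max_iff_disj)
    qed (use w c i \<beta>_props in auto)
    also have "(\<integral>x. centered (x i) \<partial>points {1..n}) = 0"
      using integral_points_component[OF _ centered_measurable, of i "{1..n}"] i integral_centered by simp
    finally show ?thesis by simp
  qed
  have "(\<integral>x. ?w x * (\<Sum>i=1..n. centered (x i)) \<partial>points {1..n})
      = (\<Sum>i=1..n. \<integral>x. ?w x * centered (x i) \<partial>points {1..n})"
    unfolding sum_distrib_left using int by (intro Bochner_Integration.integral_sum) auto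
  also have "\<dots> = (\<Sum>i\<in>\<beta> ` {1..k}. \<integral>x. ?w x * centered (x i) \<partial>points {1..n})"
    using zero \<beta>_props(2) by (intro sum.mono_neutral_right) auto
  also have "\<dots> = (\<Sum>u=1..k. \<integral>x. rooted u x * centered x \<partial>\<mu>)"
    using integral_image_weight_component[OF _ centered_measurable centered_bound]
    by (subst sum.reindex[OF \<beta>_props(1)]) simp
  finally show ?thesis
    by (simp only: sum_integral_rooted_centered)
qed

end

lemma integral_sum_centered_squared:
  "(\<integral>x. (\<Sum>i=1..n. centered (x i))\<^sup>2 \<partial>points {1..n}) = real n * projection_variance"
proof -
  have c: "(\<lambda>x. centered (x i)) \<in> borel_measurable (points {1..n})" if "i \<in> {1..n}" for i
    by (rule component_measurable[OF that centered_measurable])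
  have int: "integrable (points {1..n}) (\<lambda>x. centered (x i) * centered (x j))"
    if "i \<in> {1..n}" "j \<in> {1..n}" for i j
  proof (rule integrable_bounded_points)
    show "\<bar>centered (x i) * centered (x j)\<bar> \<le> real k * real k" for x
      unfolding abs_mult using centered_bound by (intro mult_mono) auto
  qed (use c that in simp)
  have val: "(\<integral>x. centered (x i) * centered (x j) \<partial>points {1..n}) = (if i = j then projection_variance else 0)"
    if ij: "i \<in> {1..n}" "j \<in> {1..n}" for i j
  proof (cases "i = j")
    case True
    then show ?thesis
      using integral_points_component[OF ij(1), of "\<lambda>x. (centered x)\<^sup>2"] centered_measurable
      by (simp add: projection_variance_def power2_eq_square)
  next
    case False
    have "(\<integral>x. centered (x i) * centered (x j) \<partial>points {1..n}) =
        (\<integral>x. centered (x i) \<partial>points {1..n}) * (\<integral>x. centered (x j) \<partial>points {1..n})"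
      by (rule integral_points_factor[of _ "{i}" _ "real k"])
        (use ij False c centered_bound in \<open>auto simp: depends_on_def\<close>)
    then show ?thesis
      using integral_points_component[OF ij(1) centered_measurable] False integral_centered by simp
  qed
  have "(\<integral>x. (\<Sum>i=1..n. centered (x i))\<^sup>2 \<partial>points {1..n})
      = (\<integral>x. (\<Sum>i=1..n. \<Sum>j=1..n. centered (x i) * centered (x j)) \<partial>points {1..n})"
    by (simp add: power2_eq_square sum_product)
  also have "\<dots> = (\<Sum>i=1..n. \<integral>x. (\<Sum>j=1..n. centered (x i) * centered (x j)) \<partial>points {1..n})"
    by (intro Bochner_Integration.integral_sum Bochner_Integration.integrable_sum int)
  also have "\<dots> = (\<Sum>i=1..n. \<Sum>j=1..n. \<integral>x. centered (x i) * centered (x j) \<partial>points {1..n})"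
    by (intro sum.cong refl Bochner_Integration.integral_sum int)
  also have "\<dots> = (\<Sum>i=1..n. \<Sum>j=1..n. if i = j then projection_variance else 0)"
    by (intro sum.cong refl val)
  also have "\<dots> = real n * projection_variance"
    by simp
  finally show ?thesis .
qed

end

section \<open>The number of copies\<close>

locale random_connection_graph =
  connection_graph \<mu> H k E + model: binomial_random_connection M \<mu> H p n X R
  for \<mu> :: "'a::euclidean_space measure" and H k E
    and M :: "'w measure" and p :: real and n :: nat and X :: "nat \<Rightarrow> 'w \<Rightarrow> 'a" and R +
  assumes n_pos: "n \<ge> 1" and k_ge_2: "k \<ge> 2" and p_range: "0 < p" "p < 1"
begin

definition positions :: "'w \<Rightarrow> nat \<Rightarrow> 'a" where
  "positions \<omega> = (\<lambda>i\<in>{1..n}. X i \<omega>)"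

definition present :: "nat set set \<Rightarrow> 'w set" where
  "present T = {\<omega> \<in> space M. T \<subseteq> R \<omega>}"

text \<open>Labelled embeddings, without division by the number of automorphisms, which cancels in
  the normalized count.\<close>

definition copies :: "'w \<Rightarrow> real" where
  "copies \<omega> = (\<Sum>\<beta>\<in>embeddings k n. of_bool ((`) \<beta> ` E \<subseteq> R \<omega>))"

lemma finite_vertex_pairs: "finite (vertex_pairs n)"
  unfolding vertex_pairs_def by (rule finite_subset[of _ "Pow {1..n}"]) auto

lemma vertex_pairs_edges: "T \<subseteq> vertex_pairs n \<Longrightarrow> e \<in> T \<Longrightarrow> e \<subseteq> {1..n} \<and> card e = 2"
  by (auto simp: vertex_pairs_def)

lemma sets_points: "sets (points {1..n}) = sets (PiM {1..n} (\<lambda>_. borel))"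
  by (intro sets_PiM_cong refl sets_mu)

lemma X_measurable: "i \<in> {1..n} \<Longrightarrow> X i \<in> M \<rightarrow>\<^sub>M borel"
  using model.indep_points unfolding model.indep_vars_def by blast

lemma positions_measurable: "positions \<in> M \<rightarrow>\<^sub>M PiM {1..n} (\<lambda>_. borel)"
  unfolding positions_def[abs_def] by (intro measurable_restrict X_measurable)

lemma distr_positions: "distr M (PiM {1..n} (\<lambda>_. borel)) positions = points {1..n}"
proof -
  have "distr M (PiM {1..n} (\<lambda>_. borel)) (\<lambda>\<omega>. \<lambda>i\<in>{1..n}. X i \<omega>) = PiM {1..n} (\<lambda>i. distr M borel (X i))"
    using model.indep_vars_iff_distr_eq_PiM'[where I = "{1..n}" and M' = "\<lambda>_. borel" and X = X] n_pos X_measurable model.indep_points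
    by auto
  also have "\<dots> = points {1..n}"
    by (intro PiM_cong refl model.distr_points)
  finally show ?thesis
    by (simp add: positions_def[abs_def])
qed

lemma measurable_positions:
  fixes f :: "(nat \<Rightarrow> 'a) \<Rightarrow> real"
  assumes "f \<in> borel_measurable (points {1..n})"
  shows "f \<in> borel_measurable (PiM {1..n} (\<lambda>_. borel))" "(\<lambda>\<omega>. f (positions \<omega>)) \<in> borel_measurable M"
proof -
  show *: "f \<in> borel_measurable (PiM {1..n} (\<lambda>_. borel))"
    using assms measurable_cong_sets[OF sets_points refl] by blast
  show "(\<lambda>\<omega>. f (positions \<omega>)) \<in> borel_measurable M"
    by (rule measurable_compose[OF positions_measurable *])
qed

lemma integral_positions:
  fixes f :: "(nat \<Rightarrow> 'a) \<Rightarrow> real"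
  assumes "f \<in> borel_measurable (points {1..n})"
  shows "(\<integral>\<omega>. f (positions \<omega>) \<partial>M) = (\<integral>x. f x \<partial>points {1..n})"
  using integral_distr[OF positions_measurable measurable_positions(1)[OF assms]]
  by (simp only: distr_positions)

lemma present_measurable:
  assumes "T \<subseteq> vertex_pairs n"
  shows "present T \<in> sets M"
proof -
  have "present T = space M \<inter> (\<Inter>e\<in>T. {\<omega> \<in> space M. e \<in> R \<omega>})"
    by (auto simp: present_def)
  moreover have "\<dots> \<in> sets M"
  proof (cases "T = {}")
    case False
    then show ?thesis
      using assms finite_subset[OF assms finite_vertex_pairs] model.edges_measurable
      by (intro sets.Int sets.top sets.finite_INT) auto
  qed simp
  ultimately show ?thesis by simp
qed

lemma edges_weight_pairs_measurable:
  "T \<subseteq> vertex_pairs n \<Longrightarrow> edges_weight H T \<in> borel_measurable (points {1..n})"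
  by (intro edges_weight_measurable vertex_pairs_edges)

text \<open>A function of the points is measurable for the conditioning sigma-algebra, so the
  indicator may be replaced by its conditional expectation. With f = 1 this gives probabilities,
  with the projection sum it gives covariances.\<close>

lemma expectation_present:
  fixes f :: "(nat \<Rightarrow> 'a) \<Rightarrow> real"
  assumes T: "T \<subseteq> vertex_pairs n"
    and f: "f \<in> borel_measurable (points {1..n})" "\<And>x. \<bar>f x\<bar> \<le> B"
  shows "(\<integral>\<omega>. indicator (present T) \<omega> * f (positions \<omega>) \<partial>M) =
    p ^ card T * (\<integral>x. edges_weight H T x * f x \<partial>points {1..n})"
proof -
  let ?F = "vimage_algebra (space M) (\<lambda>\<omega>. \<lambda>i\<in>{1..n}. X i \<omega>) (PiM {1..n} (\<lambda>_. borel))"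
  have pos: "positions \<in> space M \<rightarrow> space (PiM {1..n} (\<lambda>_. borel))"
    using measurable_space[OF positions_measurable] by auto
  have "subalgebra M ?F"
    unfolding subalgebra_def
    using sets_image_in_sets[OF refl positions_measurable] by (simp add: positions_def[abs_def])
  then interpret F: finite_measure_subalgebra M ?F
    by unfold_locales
  have fF: "(\<lambda>\<omega>. f (positions \<omega>)) \<in> borel_measurable ?F"
    using measurable_compose[OF measurable_vimage_algebra1[OF pos] measurable_positions(1)[OF f(1)]]
    by (simp add: positions_def[abs_def])
  note fM = measurable_positions(2)[OF f(1)]
  note wM = measurable_positions(2)[OF edges_weight_pairs_measurable[OF T]]
  have ind: "indicator (present T) \<in> borel_measurable M"
    using present_measurable[OF T] by simp
  have "\<bar>f (positions \<omega>) * indicator (present T) \<omega>\<bar> \<le> B" for \<omega>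
    using f(2)[of "positions \<omega>"] by (auto simp: indicator_def)
  then have int: "integrable M (\<lambda>\<omega>. f (positions \<omega>) * indicator (present T) \<omega>)"
    by (intro model.integrable_const_bound[of _ B] borel_measurable_times[OF fM ind]) auto
  have "(\<integral>\<omega>. indicator (present T) \<omega> * f (positions \<omega>) \<partial>M) = (\<integral>\<omega>. f (positions \<omega>) * indicator (present T) \<omega> \<partial>M)"
    by (simp add: mult.commute)
  also have "\<dots> = (\<integral>\<omega>. f (positions \<omega>) * real_cond_exp M ?F (indicator (present T)) \<omega> \<partial>M)"
    by (rule F.real_cond_exp_intg(2)[OF int fF ind, symmetric])
  also have "\<dots> = (\<integral>\<omega>. f (positions \<omega>) * (p ^ card T * edges_weight H T (positions \<omega>)) \<partial>M)"
  proof (rule integral_cong_AE)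
    show "(\<lambda>\<omega>. f (positions \<omega>) * real_cond_exp M ?F (indicator (present T)) \<omega>) \<in> borel_measurable M"
      by (intro borel_measurable_times fM borel_measurable_cond_exp2)
    show "(\<lambda>\<omega>. f (positions \<omega>) * (p ^ card T * edges_weight H T (positions \<omega>))) \<in> borel_measurable M"
      by (intro borel_measurable_times borel_measurable_const fM wM)
    \<comment> \<open>\<open>positions\<close> agrees with the points only at indices in
      \<open>{1..n}\<close>, where all endpoints of edges of T lie.\<close>
    have prod_eq: "(\<Prod>e\<in>T. p * edge_weight H (\<lambda>i. X i \<omega>) e) = p ^ card T * edges_weight H T (positions \<omega>)" for \<omega>
    proof -
      have "edges_weight H T (\<lambda>i. X i \<omega>) = edges_weight H T (positions \<omega>)"
        using vertex_pairs_edges[OF T]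
        by (intro depends_onD[OF depends_on_edges_weight[of T "{1..n}"]]) (auto simp: positions_def)
      then show ?thesis
        by (simp add: prod.distrib edges_weight_def)
    qed
    show "AE \<omega> in M. f (positions \<omega>) * real_cond_exp M ?F (indicator (present T)) \<omega>
        = f (positions \<omega>) * (p ^ card T * edges_weight H T (positions \<omega>))"
      using model.edges_given_points[OF T] unfolding present_def
      by eventually_elim (simp only: prod_eq)
  qed
  also have "\<dots> = p ^ card T * (\<integral>\<omega>. edges_weight H T (positions \<omega>) * f (positions \<omega>) \<partial>M)"
    by (subst Bochner_Integration.integral_mult_right_zero[symmetric]) (simp add: mult_ac)
  also have "(\<integral>\<omega>. edges_weight H T (positions \<omega>) * f (positions \<omega>) \<partial>M) = (\<integral>x. edges_weight H T x * f x \<partial>points {1..n})"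
    by (intro integral_positions borel_measurable_times edges_weight_pairs_measurable T f)
  finally show ?thesis .
qed

lemma prob_present:
  assumes T: "T \<subseteq> vertex_pairs n"
  shows "model.prob (present T) = p ^ card T * (\<integral>x. edges_weight H T x \<partial>points {1..n})"
  using expectation_present[OF T, of "\<lambda>_. 1" 1] present_measurable[OF T] by simp

lemma prob_present_le:
  assumes T: "T \<subseteq> vertex_pairs n"
  shows "model.prob (present T) \<le> p ^ card T"
proof -
  interpret P: prob_space "points {1..n}" by (rule prob_space_points)
  have "(\<integral>x. edges_weight H T x \<partial>points {1..n}) \<le> (\<integral>x. 1 \<partial>points {1..n})"
    using edges_weight_range
    by (intro integral_mono integrable_bounded_points[OF edges_weight_pairs_measurable[OF T], of 1] P.integrable_const) auto
  then have "(\<integral>x. edges_weight H T x \<partial>points {1..n}) \<le> 1"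
    using P.prob_space by simp
  then show ?thesis
    using p_range prob_present[OF T] mult_left_mono[of "\<integral>x. edges_weight H T x \<partial>points {1..n}" 1 "p ^ card T"] by simp
qed

text \<open>Edges of T lie inside V and those of T' outside it, so the power of p splits by
  disjointness and the integral splits by independence of the two groups of points.\<close>

lemma prob_present_Un:
  assumes T: "T \<subseteq> vertex_pairs n" "T' \<subseteq> vertex_pairs n"
    and V: "\<And>e. e \<in> T \<Longrightarrow> e \<subseteq> V" "\<And>e. e \<in> T' \<Longrightarrow> e \<inter> V = {}"
  shows "model.prob (present (T \<union> T')) = model.prob (present T) * model.prob (present T')"
proof -
  have fin: "finite T" "finite T'"
    using T finite_subset finite_vertex_pairs by auto
  \<comment> \<open>An empty edge would both lie inside V and avoid V, so disjointness of T and T'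
    needs nonempty edges.\<close>
  have "e \<noteq> {}" if "e \<in> T" for e
    using T(1) that by (auto simp: vertex_pairs_def)
  then have disj: "T \<inter> T' = {}"
    using V by blast
  have w: "edges_weight H (T \<union> T') x = edges_weight H T x * edges_weight H T' x" for x
    unfolding edges_weight_def by (rule prod.union_disjoint[OF fin disj])
  have "(\<integral>x. edges_weight H T x * edges_weight H T' x \<partial>points {1..n}) =
      (\<integral>x. edges_weight H T x \<partial>points {1..n}) * (\<integral>x. edges_weight H T' x \<partial>points {1..n})"
  proof (rule integral_points_factor[of _ "V \<inter> {1..n}" _ 1])
    show "depends_on (V \<inter> {1..n}) (edges_weight H T)"
      using vertex_pairs_edges[OF T(1)] V(1) by (intro depends_on_edges_weight) blast
    show "depends_on ({1..n} - V \<inter> {1..n}) (edges_weight H T')"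
      using vertex_pairs_edges[OF T(2)] V(2) by (intro depends_on_edges_weight) blast
  qed (use edges_weight_range edges_weight_pairs_measurable T in auto)
  then show ?thesis
    using T fin disj by (simp add: prob_present w card_Un_disjoint power_add)
qed

lemma image_edges_vertex_pairs: "\<beta> \<in> embeddings k n \<Longrightarrow> (`) \<beta> ` E \<subseteq> vertex_pairs n"
  using image_edges unfolding vertex_pairs_def by blast

lemma union_edges_vertex_pairs:
  "\<alpha> \<in> S \<rightarrow>\<^sub>E embeddings k n \<Longrightarrow> T \<subseteq> S \<Longrightarrow> union_edges E \<alpha> T \<subseteq> vertex_pairs n"
  unfolding union_edges_def using image_edges_vertex_pairs by (intro UN_least) (auto simp: PiE_iff)

lemma copy_eq_indicator:
  "\<omega> \<in> space M \<Longrightarrow> of_bool ((`) \<beta> ` E \<subseteq> R \<omega>) = indicator (present ((`) \<beta> ` E)) \<omega>"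
  by (auto simp: present_def)

lemma simple_function_copy:
  assumes "\<beta> \<in> embeddings k n"
  shows "simple_function M (\<lambda>\<omega>. of_bool ((`) \<beta> ` E \<subseteq> R \<omega>) :: real)"
proof -
  have "simple_function M (indicator (present ((`) \<beta> ` E)) :: 'w \<Rightarrow> real)"
    by (intro simple_function_indicator present_measurable image_edges_vertex_pairs assms)
  then show ?thesis
    by (subst simple_function_cong[OF copy_eq_indicator]) auto
qed

lemma simple_function_copies: "simple_function M copies"
  unfolding copies_def[abs_def] by (intro simple_function_sum simple_function_copy)

lemma expectation_prod_copies:
  assumes "\<alpha> \<in> S \<rightarrow>\<^sub>E embeddings k n" "T \<subseteq> S" "finite S"
  shows "(\<integral>\<omega>. (\<Prod>i\<in>T. of_bool ((`) (\<alpha> i) ` E \<subseteq> R \<omega>)) \<partial>M) = model.prob (present (union_edges E \<alpha> T))"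
proof -
  have "finite T"
    using assms finite_subset by blast
  then have eq: "(\<Prod>i\<in>T. of_bool ((`) (\<alpha> i) ` E \<subseteq> R \<omega>)) = (of_bool (\<forall>i\<in>T. (`) (\<alpha> i) ` E \<subseteq> R \<omega>) :: real)" for \<omega>
    by (induction T rule: finite_induct) auto
  have "(\<integral>\<omega>. (\<Prod>i\<in>T. of_bool ((`) (\<alpha> i) ` E \<subseteq> R \<omega>)) \<partial>M)
      = (\<integral>\<omega>. indicat_real (present (union_edges E \<alpha> T)) \<omega> \<partial>M)"
    unfolding eq by (intro Bochner_Integration.integral_cong) (auto simp: present_def union_edges_def indicator_def)
  also have "\<dots> = model.prob (present (union_edges E \<alpha> T))"
    using present_measurable[OF union_edges_vertex_pairs[OF assms(1,2)]] by simp
  finally show ?thesis .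
qed

text \<open>The joint moment of a subfamily is the probability that its union is present. The
  majorant for \<open>joint_cumulant_bound\<close> is p to the number of edges in that union;
  overlaps only reduce this number, so for p < 1 the majorant is supermultiplicative.\<close>

lemma cumulant_copies_le:
  assumes bal: "strongly_balanced {1..k} E" and j: "j \<ge> 1"
    and q: "q = p powr (real (card E) / (real k - 1))"
    and B: "\<And>v. k \<le> v \<Longrightarrow> v \<le> j * (k - 1) + 1 \<Longrightarrow> real n ^ v * q ^ (v - 1) \<le> B"
  shows "cumulant M j copies \<le> real j ^ (j - 1) * real (j * k) ^ (k * j + 1) * B"
proof -
  let ?S = "{..<j}"
  define m :: "(nat \<Rightarrow> nat \<Rightarrow> nat) \<Rightarrow> nat set \<Rightarrow> real"
    where "m = (\<lambda>\<alpha> S. \<integral>\<omega>. (\<Prod>i\<in>S. of_bool ((`) (\<alpha> i) ` E \<subseteq> R \<omega>)) \<partial>M)"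
  have S: "finite ?S" "?S \<noteq> {}" "card ?S = j"
    using j by (auto simp: lessThan_empty_iff)
  have fE: "finite E"
    using graph by (rule finite_edges)
  have m: "m \<alpha> T = model.prob (present (union_edges E \<alpha> T))" if "\<alpha> \<in> ?S \<rightarrow>\<^sub>E embeddings k n" "T \<subseteq> ?S" for \<alpha> T
    unfolding m_def by (rule expectation_prod_copies[OF that S(1)])
  have m0: "m \<alpha> {} = 1" for \<alpha>
    by (simp add: m_def model.prob_space)
  have "cumulant M j copies = (\<Sum>\<alpha>\<in>?S \<rightarrow>\<^sub>E embeddings k n. joint_cumulant (m \<alpha>) ?S)"
    unfolding copies_def[abs_def] m_def
    using model.cumulant_sum[OF finite_embeddings simple_function_copy S(1,2)] by simp
  also have "\<dots> \<le> real j ^ (j - 1) * real (card ?S * k) ^ (k * card ?S + 1) * B"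
  proof (rule sum_families_le[OF graph bal k_ge_2 S(1,2) p_range _ _ _ q])
    fix \<alpha> assume \<alpha>: "\<alpha> \<in> ?S \<rightarrow>\<^sub>E embeddings k n"
    let ?b = "\<lambda>T. p ^ card (union_edges E \<alpha> T)"
    have "\<bar>joint_cumulant (m \<alpha>) ?S\<bar> \<le> real (card ?S) ^ (card ?S - 1) * ?b ?S"
    proof (rule joint_cumulant_bound[OF S(1,2)])
      show "\<bar>m \<alpha> T\<bar> \<le> ?b T" if "T \<subseteq> ?S" for T
        unfolding m[OF \<alpha> that] using prob_present_le[OF union_edges_vertex_pairs[OF \<alpha> that]] by simp
      show "?b T * ?b U \<le> ?b (T \<union> U)" for T U
      proof -
        have "union_edges E \<alpha> (T \<union> U) = union_edges E \<alpha> T \<union> union_edges E \<alpha> U"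
          by (auto simp: union_edges_def)
        then show ?thesis
          using p_range card_Un_le[of "union_edges E \<alpha> T" "union_edges E \<alpha> U"]
          by (simp add: power_add[symmetric] power_decreasing)
      qed
    qed
    then show "joint_cumulant (m \<alpha>) ?S \<le> real j ^ (j - 1) * ?b ?S"
      by simp
  next
    fix \<alpha> assume \<alpha>: "\<alpha> \<in> ?S \<rightarrow>\<^sub>E embeddings k n" and "\<not> connected_family k \<alpha> ?S"
    then obtain T where T: "T \<noteq> {}" "T \<subset> ?S" "union_vertices k \<alpha> T \<inter> union_vertices k \<alpha> (?S - T) = {}"
      unfolding connected_family_def by blast
    \<comment> \<open>The two sides of the failing cut use disjoint vertex sets, so the moment of
      every subfamily factors along it.\<close>
    have "joint_cumulant (m \<alpha>) ?S = 0"
    proof (rule joint_cumulant_eq_0[OF S(1), of T "?S - T" "m \<alpha>"])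
      fix U assume U: "U \<subseteq> ?S"
      have sub: "U \<inter> T \<subseteq> ?S" "U \<inter> (?S - T) \<subseteq> ?S" using U by auto
      have eq: "union_edges E \<alpha> U = union_edges E \<alpha> (U \<inter> T) \<union> union_edges E \<alpha> (U \<inter> (?S - T))"
        using U by (auto simp: union_edges_def)
      have mono: "union_vertices k \<alpha> (U \<inter> T) \<subseteq> union_vertices k \<alpha> T"
          "union_vertices k \<alpha> (U \<inter> (?S - T)) \<subseteq> union_vertices k \<alpha> (?S - T)"
        by (auto simp: union_vertices_def)
      show "m \<alpha> U = m \<alpha> (U \<inter> T) * m \<alpha> (U \<inter> (?S - T))"
        unfolding m[OF \<alpha> U] m[OF \<alpha> sub(1)] m[OF \<alpha> sub(2)] eq
      proof (rule prob_present_Un[where V = "union_vertices k \<alpha> T"])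
        show "e \<subseteq> union_vertices k \<alpha> T" if "e \<in> union_edges E \<alpha> (U \<inter> T)" for e
          using union_edges_subset_union_vertices[OF graph that] mono by blast
        show "e \<inter> union_vertices k \<alpha> T = {}" if "e \<in> union_edges E \<alpha> (U \<inter> (?S - T))" for e
          using union_edges_subset_union_vertices[OF graph that] mono T(3) by blast
      qed (intro union_edges_vertex_pairs[OF \<alpha>] sub)+
    qed (use T m0 in auto)
    then show "joint_cumulant (m \<alpha>) ?S \<le> 0" by simp
  next
    fix v assume "k \<le> v" "v \<le> card ?S * (k - 1) + 1"
    then show "real n ^ v * q ^ (v - 1) \<le> B"
      using B by simp
  qed simp
  finally show ?thesis
    by simp
qed

section \<open>Mean and variance of the number of labelled copies\<close>

abbreviation mean :: real where
  "mean \<equiv> real (card (embeddings k n)) * (p ^ card E * graph_density)"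

lemma prob_present_image: "\<beta> \<in> embeddings k n \<Longrightarrow> model.prob (present ((`) \<beta> ` E)) = p ^ card E * graph_density"
  using prob_present[OF image_edges_vertex_pairs] by (simp only: integral_image_weight card_image_edges)

lemma expectation_copy:
  "\<beta> \<in> embeddings k n \<Longrightarrow> (\<integral>\<omega>. of_bool ((`) \<beta> ` E \<subseteq> R \<omega>) \<partial>M) = p ^ card E * graph_density"
  using expectation_prod_copies[of "\<lambda>_\<in>{0}. \<beta>" "{0}" "{0}"] prob_present_image
  by (simp add: union_edges_def)

lemma expectation_copies: "(\<integral>\<omega>. copies \<omega> \<partial>M) = mean"
  unfolding copies_def
  by (subst Bochner_Integration.integral_sum)
    (auto simp: expectation_copy intro!: model.integrable_simple_function simple_function_copy)

lemma expectation_copy_mult: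
  assumes "\<beta> \<in> embeddings k n" "\<beta>' \<in> embeddings k n"
  shows "(\<integral>\<omega>. of_bool ((`) \<beta> ` E \<subseteq> R \<omega>) * of_bool ((`) \<beta>' ` E \<subseteq> R \<omega>) \<partial>M)
    = model.prob (present ((`) \<beta> ` E \<union> (`) \<beta>' ` E))"
  using expectation_prod_copies[of "\<lambda>i\<in>{0,1}. if i = 0 then \<beta> else \<beta>'" "{0,1}" "{0,1}"] assms
  by (simp add: union_edges_def)

lemma cumulant_2_copies:
  "cumulant M 2 copies = (\<integral>\<omega>. (copies \<omega>)\<^sup>2 \<partial>M) - mean\<^sup>2"
  using model.cumulant_2[OF simple_function_copies] by (simp add: expectation_copies)

lemma expectation_copies_squared:
  "(\<integral>\<omega>. (copies \<omega>)\<^sup>2 \<partial>M) = (\<Sum>\<beta>\<in>embeddings k n. \<Sum>\<beta>'\<in>embeddings k n.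
     model.prob (present ((`) \<beta> ` E \<union> (`) \<beta>' ` E)))"
proof -
  let ?I = "\<lambda>\<beta> \<omega>. of_bool ((`) \<beta> ` E \<subseteq> R \<omega>) :: real"
  have int: "integrable M (\<lambda>\<omega>. ?I \<beta> \<omega> * ?I \<beta>' \<omega>)" if "\<beta> \<in> embeddings k n" "\<beta>' \<in> embeddings k n" for \<beta> \<beta>'
    by (intro model.integrable_simple_function simple_function_mult simple_function_copy that)
  have "(\<integral>\<omega>. (copies \<omega>)\<^sup>2 \<partial>M) = (\<integral>\<omega>. (\<Sum>\<beta>\<in>embeddings k n. \<Sum>\<beta>'\<in>embeddings k n. ?I \<beta> \<omega> * ?I \<beta>' \<omega>) \<partial>M)"
    by (simp only: copies_def power2_eq_square sum_product)
  also have "\<dots> = (\<Sum>\<beta>\<in>embeddings k n. \<integral>\<omega>. (\<Sum>\<beta>'\<in>embeddings k n. ?I \<beta> \<omega> * ?I \<beta>' \<omega>) \<partial>M)"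
    by (intro Bochner_Integration.integral_sum Bochner_Integration.integrable_sum int)
  also have "\<dots> = (\<Sum>\<beta>\<in>embeddings k n. \<Sum>\<beta>'\<in>embeddings k n. \<integral>\<omega>. ?I \<beta> \<omega> * ?I \<beta>' \<omega> \<partial>M)"
    by (intro sum.cong refl Bochner_Integration.integral_sum int)
  finally show ?thesis
    by (simp only: expectation_copy_mult cong: sum.cong)
qed

text \<open>Cauchy--Schwarz against the first-order projection \<open>\<Sum>\<^sub>i centered (X\<^sub>i)\<close>.\<close>

lemma cumulant_2_ge_projection:
  assumes pos: "projection_variance > 0"
  shows "cumulant M 2 copies \<ge> (real (card (embeddings k n)) * p ^ card E)\<^sup>2 * projection_variance / real n"
proof -
  define a where "a = real (card (embeddings k n)) * p ^ card E"
  \<comment> \<open>Covariance divided by variance, with the common factor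
    \<open>projection_variance\<close> cancelled: the value that minimizes the second moment of
    \<open>copies\<close> - \<open>mean\<close> - l Z.\<close>
  define l where "l = a / real n"
  define z where "z x = (\<Sum>i=1..n. centered (x i))" for x :: "nat \<Rightarrow> 'a"
  let ?Z = "\<lambda>\<omega>. z (positions \<omega>)"
  have zM: "z \<in> borel_measurable (points {1..n})"
    unfolding z_def[abs_def] by (intro borel_measurable_sum component_measurable centered_measurable)
  note ZM = measurable_positions(2)[OF zM]
  have z_bound: "\<bar>z x\<bar> \<le> real n * real k" for x
  proof -
    have "\<bar>z x\<bar> \<le> (\<Sum>i=1..n. real k)"
      unfolding z_def by (intro order.trans[OF sum_abs] sum_mono centered_bound)
    then show ?thesis by simp
  qed
  have EZ: "(\<integral>\<omega>. ?Z \<omega> \<partial>M) = 0"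
  proof -
    have "(\<integral>\<omega>. ?Z \<omega> \<partial>M) = (\<integral>x. z x \<partial>points {1..n})"
      by (rule integral_positions[OF zM])
    also have "\<dots> = (\<Sum>i=1..n. \<integral>x. centered (x i) \<partial>points {1..n})"
      unfolding z_def using centered_bound
      by (intro Bochner_Integration.integral_sum integrable_bounded_points component_measurable centered_measurable) auto
    also have "\<dots> = 0"
      using integral_points_component[OF _ centered_measurable] integral_centered by simp
    finally show ?thesis .
  qed
  have EZ2: "(\<integral>\<omega>. (?Z \<omega>)\<^sup>2 \<partial>M) = real n * projection_variance"
    using integral_positions[OF borel_measurable_power[OF zM], of 2] integral_sum_centered_squared[of n]
    by (simp only: z_def)
  have Y_int: "integrable M copies" "integrable M (\<lambda>\<omega>. (copies \<omega>)\<^sup>2)"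
    using simple_function_copies simple_function_compose[OF simple_function_copies, of "\<lambda>y. y\<^sup>2"]
    by (auto intro!: model.integrable_simple_function simp: comp_def)
  have Z_int: "integrable M ?Z" "integrable M (\<lambda>\<omega>. (?Z \<omega>)\<^sup>2)"
  proof -
    show "integrable M ?Z"
      using z_bound ZM by (intro model.integrable_const_bound[of _ "real n * real k"]) auto
    show "integrable M (\<lambda>\<omega>. (?Z \<omega>)\<^sup>2)"
      using ZM power_mono[OF z_bound abs_ge_zero, of _ 2]
      by (intro model.integrable_const_bound[of _ "(real n * real k)\<^sup>2"]) auto
  qed
  have copy_Z: "integrable M (\<lambda>\<omega>. of_bool ((`) \<beta> ` E \<subseteq> R \<omega>) * ?Z \<omega>)"
      "(\<integral>\<omega>. of_bool ((`) \<beta> ` E \<subseteq> R \<omega>) * ?Z \<omega> \<partial>M) = p ^ card E * projection_variance"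
    if \<beta>: "\<beta> \<in> embeddings k n" for \<beta>
  proof -
    show "integrable M (\<lambda>\<omega>. of_bool ((`) \<beta> ` E \<subseteq> R \<omega>) * ?Z \<omega>)"
    proof (rule model.integrable_const_bound[of _ "real n * real k"])
      show "AE \<omega> in M. norm (of_bool ((`) \<beta> ` E \<subseteq> R \<omega>) * ?Z \<omega>) \<le> real n * real k"
        using z_bound by (auto simp: of_bool_def)
      show "(\<lambda>\<omega>. of_bool ((`) \<beta> ` E \<subseteq> R \<omega>) * ?Z \<omega>) \<in> borel_measurable M"
        by (intro borel_measurable_times ZM borel_measurable_simple_function simple_function_copy \<beta>)
    qed
    have "(\<integral>\<omega>. of_bool ((`) \<beta> ` E \<subseteq> R \<omega>) * ?Z \<omega> \<partial>M) = (\<integral>\<omega>. indicator (present ((`) \<beta> ` E)) \<omega> * ?Z \<omega> \<partial>M)"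
      by (intro Bochner_Integration.integral_cong refl) (simp only: copy_eq_indicator)
    also have "\<dots> = p ^ card E * projection_variance"
      using expectation_present[OF image_edges_vertex_pairs[OF \<beta>] zM z_bound]
        integral_image_weight_centered[OF \<beta>] card_image_edges[OF \<beta>] by (simp add: z_def)
    finally show "(\<integral>\<omega>. of_bool ((`) \<beta> ` E \<subseteq> R \<omega>) * ?Z \<omega> \<partial>M) = p ^ card E * projection_variance" .
  qed
  have YZ_int: "integrable M (\<lambda>\<omega>. copies \<omega> * ?Z \<omega>)"
    unfolding copies_def sum_distrib_right by (intro Bochner_Integration.integrable_sum copy_Z)
  have EYZ: "(\<integral>\<omega>. copies \<omega> * ?Z \<omega> \<partial>M) = a * projection_variance"
  proof -
    have "(\<integral>\<omega>. copies \<omega> * ?Z \<omega> \<partial>M) = (\<Sum>\<beta>\<in>embeddings k n. \<integral>\<omega>. of_bool ((`) \<beta> ` E \<subseteq> R \<omega>) * ?Z \<omega> \<partial>M)"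
      unfolding copies_def sum_distrib_right by (intro Bochner_Integration.integral_sum copy_Z)
    then show ?thesis
      by (simp add: copy_Z(2) a_def)
  qed
  have "0 \<le> (\<integral>\<omega>. (copies \<omega> - mean - l * ?Z \<omega>)\<^sup>2 \<partial>M)"
    by (rule integral_nonneg_AE) simp
  also have "\<dots> = (\<integral>\<omega>. (copies \<omega>)\<^sup>2 + (- 2 * mean) * copies \<omega> + mean\<^sup>2 + (- 2 * l) * (copies \<omega> * ?Z \<omega>)
      + (2 * l * mean) * ?Z \<omega> + l\<^sup>2 * (?Z \<omega>)\<^sup>2 \<partial>M)"
    by (intro Bochner_Integration.integral_cong refl) (simp add: power2_eq_square algebra_simps)
  also have "\<dots> = (\<integral>\<omega>. (copies \<omega>)\<^sup>2 \<partial>M) + (- 2 * mean) * mean + mean\<^sup>2 + (- 2 * l) * (a * projection_variance)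
      + (2 * l * mean) * 0 + l\<^sup>2 * (real n * projection_variance)"
    by (simp only: Bochner_Integration.integral_add Bochner_Integration.integrable_add integrable_mult_right
        Y_int Z_int YZ_int model.integrable_const Bochner_Integration.integral_mult_right_zero
        EZ EZ2 EYZ expectation_copies lebesgue_integral_const model.prob_space) simp
  also have "\<dots> = cumulant M 2 copies - a\<^sup>2 * projection_variance / real n"
    using n_pos by (simp add: cumulant_2_copies l_def power2_eq_square field_simps)
  finally show ?thesis
    by (simp add: a_def)
qed

text \<open>A meeting is witnessed by a pair (u, w) with \<beta>' w = \<beta> u. There are k^2
  pairs, and each fixes one value of \<beta>' and leaves k - 1 free.\<close>

lemma card_embeddings_meeting:
  assumes \<beta>: "\<beta> \<in> embeddings k n"
  shows "card {\<beta>' \<in> embeddings k n. \<beta> ` {1..k} \<inter> \<beta>' ` {1..k} \<noteq> {}} \<le> k\<^sup>2 * n ^ (k - 1)"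
proof -
  let ?C = "\<lambda>(u, w). PiE {1..k} (\<lambda>i. if i = w then {\<beta> u} else {1..n})"
  let ?K = "{1..k} \<times> {1..k}"
  have "{\<beta>' \<in> embeddings k n. \<beta> ` {1..k} \<inter> \<beta>' ` {1..k} \<noteq> {}} \<subseteq> (\<Union>z\<in>?K. ?C z)"
  proof
    fix \<beta>' assume \<beta>': "\<beta>' \<in> {\<beta>' \<in> embeddings k n. \<beta> ` {1..k} \<inter> \<beta>' ` {1..k} \<noteq> {}}"
    then obtain u w where uw: "u \<in> {1..k}" "w \<in> {1..k}" "\<beta>' w = \<beta> u"
      by fastforce
    then have "\<beta>' \<in> ?C (u, w)"
      using \<beta>' by (auto simp: embeddings_def PiE_iff)
    then show "\<beta>' \<in> (\<Union>z\<in>?K. ?C z)"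
      using uw by blast
  qed
  moreover have "finite (\<Union>z\<in>?K. ?C z)"
    by (auto intro!: finite_PiE)
  ultimately have "card {\<beta>' \<in> embeddings k n. \<beta> ` {1..k} \<inter> \<beta>' ` {1..k} \<noteq> {}} \<le> card (\<Union>z\<in>?K. ?C z)"
    by (rule card_mono[rotated])
  also have "\<dots> \<le> (\<Sum>z\<in>?K. card (?C z))"
    by (rule card_UN_le) simp
  also have "\<dots> = (\<Sum>z\<in>?K. n ^ (k - 1))"
  proof (intro sum.cong refl)
    fix z assume "z \<in> ?K"
    then obtain u w where z: "z = (u, w)" "w \<in> {1..k}" by auto
    have "card (?C z) = (\<Prod>i\<in>{1..k}. card (if i = w then {\<beta> u} else {1..n}))"
      unfolding z(1) by (simp add: card_PiE)
    also have "\<dots> = (\<Prod>i\<in>{1..k} - {w}. n)"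
      using z(2) by (subst prod.remove[of _ w]) auto
    finally show "card (?C z) = n ^ (k - 1)"
      using z(2) by simp
  qed
  finally show ?thesis
    by (simp add: power2_eq_square)
qed

text \<open>In the double sum for the variance, pairs with disjoint vertex sets contribute 0. Among
  the meeting pairs, only the probability for \<beta>' = \<beta> is kept, while all subtracted
  squares are bounded; this loss is of second order in p^e(G).\<close>

lemma cumulant_2_ge_diagonal:
  "cumulant M 2 copies \<ge> real (card (embeddings k n)) *
     (p ^ card E * graph_density - (real k)\<^sup>2 * real n ^ (k - 1) * (p ^ card E)\<^sup>2)"
proof -
  let ?A = "embeddings k n" and ?q = "p ^ card E * graph_density"
  let ?P = "\<lambda>\<beta> \<beta>'. model.prob (present ((`) \<beta> ` E \<union> (`) \<beta>' ` E))"
  have q: "0 \<le> ?q" "?q \<le> p ^ card E"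
    using graph_density_range p_range mult_left_mono[of graph_density 1 "p ^ card E"] by auto
  have row: "?q - (real k)\<^sup>2 * real n ^ (k - 1) * (p ^ card E)\<^sup>2 \<le> (\<Sum>\<beta>'\<in>?A. ?P \<beta> \<beta>' - ?q\<^sup>2)" if \<beta>: "\<beta> \<in> ?A" for \<beta>
  proof -
    let ?N = "{\<beta>' \<in> ?A. \<beta> ` {1..k} \<inter> \<beta>' ` {1..k} \<noteq> {}}"
    have \<beta>N: "\<beta> \<in> ?N"
      using \<beta> k_ge_2 by auto
    have finN: "finite ?N"
      using finite_embeddings by simp
    have "(\<Sum>\<beta>'\<in>?A. ?P \<beta> \<beta>' - ?q\<^sup>2) = (\<Sum>\<beta>'\<in>?N. ?P \<beta> \<beta>' - ?q\<^sup>2)"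
    proof (rule sum.mono_neutral_right)
      show "\<forall>\<beta>'\<in>?A - ?N. ?P \<beta> \<beta>' - ?q\<^sup>2 = 0"
      proof
        fix \<beta>' assume \<beta>': "\<beta>' \<in> ?A - ?N"
        have "?P \<beta> \<beta>' = model.prob (present ((`) \<beta> ` E)) * model.prob (present ((`) \<beta>' ` E))"
        proof (rule prob_present_Un[where V = "\<beta> ` {1..k}"])
          show "e \<subseteq> \<beta> ` {1..k}" if "e \<in> (`) \<beta> ` E" for e
            using image_edges[OF \<beta> that] by blast
          show "e \<inter> \<beta> ` {1..k} = {}" if "e \<in> (`) \<beta>' ` E" for e
            using image_edges[of \<beta>' n e] that \<beta>' by blast
        qed (use \<beta> \<beta>' image_edges_vertex_pairs in blast)+
        then show "?P \<beta> \<beta>' - ?q\<^sup>2 = 0"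
          using \<beta> \<beta>' by (simp add: prob_present_image power2_eq_square)
      qed
    qed (use finite_embeddings in auto)
    also have "\<dots> = (\<Sum>\<beta>'\<in>?N. ?P \<beta> \<beta>') - real (card ?N) * ?q\<^sup>2"
      by (simp add: sum_subtractf)
    finally have eq: "(\<Sum>\<beta>'\<in>?A. ?P \<beta> \<beta>' - ?q\<^sup>2) = (\<Sum>\<beta>'\<in>?N. ?P \<beta> \<beta>') - real (card ?N) * ?q\<^sup>2" .
    have "?P \<beta> \<beta> \<le> (\<Sum>\<beta>'\<in>?N. ?P \<beta> \<beta>')"
      using \<beta>N finN by (intro member_le_sum) auto
    then have 1: "?q \<le> (\<Sum>\<beta>'\<in>?N. ?P \<beta> \<beta>')"
      using prob_present_image[OF \<beta>] by simp
    have "real (card ?N) * ?q\<^sup>2 \<le> real (k\<^sup>2 * n ^ (k - 1)) * (p ^ card E)\<^sup>2"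
      by (intro mult_mono of_nat_mono card_embeddings_meeting[OF \<beta>] power_mono q) auto
    then show ?thesis
      unfolding eq using 1 by simp
  qed
  have "real (card ?A) * (?q - (real k)\<^sup>2 * real n ^ (k - 1) * (p ^ card E)\<^sup>2)
      \<le> (\<Sum>\<beta>\<in>?A. \<Sum>\<beta>'\<in>?A. ?P \<beta> \<beta>' - ?q\<^sup>2)"
    using sum_bounded_below[of ?A _ "\<lambda>\<beta>. \<Sum>\<beta>'\<in>?A. ?P \<beta> \<beta>' - ?q\<^sup>2"] row by simp
  also have "\<dots> = cumulant M 2 copies"
    unfolding cumulant_2_copies expectation_copies_squared
    by (simp add: sum_subtractf power2_eq_square mult_ac)
  finally show ?thesis .
qed

lemma subgraph_count_eq: "subgraph_count k E n (R \<omega>) = 1 / real (num_automorphisms {1..k} E) * copies \<omega>"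
proof -
  have "(\<Prod>e\<in>E. of_bool (\<beta> ` e \<in> R \<omega>)) = (of_bool ((`) \<beta> ` E \<subseteq> R \<omega>) :: real)" for \<beta>
    using finite_edges[OF graph] by (induction E rule: finite_induct) auto
  then show ?thesis
    by (simp add: subgraph_count_def copies_def embeddings_def)
qed

text \<open>Scaling by 1 / a(G) multiplies numerator and denominator by the same power, and the
  shift by the mean does not affect cumulants of order at least 2.\<close>

lemma cumulant_normalized:
  assumes "num_automorphisms {1..k} E > 0" "j \<ge> 2"
  shows "cumulant M j (normalized M (\<lambda>\<omega>. subgraph_count k E n (R \<omega>)))
    = cumulant M j copies / sqrt (cumulant M 2 copies) ^ j"
proof -
  define a where "a = 1 / real (num_automorphisms {1..k} E)"
  have a: "a > 0" using assms(1) by (simp add: a_def)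
  let ?N = "\<lambda>\<omega>. a * copies \<omega>"
  have eq: "(\<lambda>\<omega>. subgraph_count k E n (R \<omega>)) = ?N"
    by (simp add: subgraph_count_eq a_def)
  have "cumulant M 2 ?N = a\<^sup>2 * cumulant M 2 copies"
    using model.cumulant_affine[OF simple_function_copies, of 2 a 0] by simp
  then have sqrt: "sqrt (cumulant M 2 ?N) = a * sqrt (cumulant M 2 copies)"
    using a by (simp add: real_sqrt_mult)
  have "normalized M ?N = (\<lambda>\<omega>. (1 / sqrt (cumulant M 2 copies)) * copies \<omega> + (- cumulant M 1 ?N / sqrt (cumulant M 2 ?N)))"
    using a by (intro ext) (simp add: normalized_def sqrt diff_divide_distrib)
  then show ?thesis
    unfolding eq by (simp only: model.cumulant_affine[OF simple_function_copies assms(2)])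
      (simp add: power_divide)
qed

end

section \<open>Cumulant bounds\<close>

context random_connection_graph
begin

lemma integral_position:
  fixes g :: "'a \<Rightarrow> real"
  assumes "g \<in> borel_measurable \<mu>" "i \<in> {1..n}"
  shows "(\<integral>\<omega>. g (X i \<omega>) \<partial>M) = (\<integral>x. g x \<partial>\<mu>)"
proof -
  have "g \<in> borel_measurable borel"
    using assms(1) measurable_cong_sets[OF sets_mu refl] by blast
  then show ?thesis
    using integral_distr[OF X_measurable[OF assms(2)], of g] model.distr_points[OF assms(2)] by simp
qed

text \<open>The sum of the vertex projections is an affine function of \<open>centered\<close>. This
  turns the variance hypothesis of the theorem into positivity of
  \<open>projection_variance\<close>, a statement free of n.\<close>

lemma variance_vertex_projection:
  "model.variance (\<lambda>\<omega>. \<Sum>l=1..k. vertex_projection k E \<mu> H p l (X 1 \<omega>)) =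
     (p ^ card E / real (num_automorphisms {1..k} E))\<^sup>2 * projection_variance"
proof -
  let ?c = "p ^ card E / real (num_automorphisms {1..k} E)"
  have eq: "(\<Sum>l=1..k. vertex_projection k E \<mu> H p l x) = ?c * centered x + ?c * (real k * graph_density)" for x
    by (simp add: vertex_projection_def centered_def rooted_def edges_weight_def sum_distrib_left
        right_diff_distrib)
  have one: "1 \<in> {1..n}"
    using n_pos by simp
  have "(\<integral>\<omega>. ?c * centered (X 1 \<omega>) + ?c * (real k * graph_density) \<partial>M)
      = (\<integral>x. ?c * centered x + ?c * (real k * graph_density) \<partial>\<mu>)"
    using centered_measurable by (intro integral_position one) simp
  also have "\<dots> = ?c * (real k * graph_density)"
  proof -
    have "integrable \<mu> centered"
      using centered_bound centered_measurable by (intro integrable_const_bound[of _ "real k"]) auto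
    then show ?thesis
      by (simp add: integral_centered prob_space)
  qed
  finally have mean_eq: "(\<integral>\<omega>. ?c * centered (X 1 \<omega>) + ?c * (real k * graph_density) \<partial>M) = ?c * (real k * graph_density)" .
  have "model.variance (\<lambda>\<omega>. \<Sum>l=1..k. vertex_projection k E \<mu> H p l (X 1 \<omega>))
      = (\<integral>\<omega>. (?c * centered (X 1 \<omega>))\<^sup>2 \<partial>M)"
    unfolding eq mean_eq by simp
  also have "\<dots> = (\<integral>x. (?c * centered x)\<^sup>2 \<partial>\<mu>)"
    using centered_measurable by (intro integral_position one) simp
  also have "\<dots> = ?c\<^sup>2 * projection_variance"
    by (simp only: power_mult_distrib Bochner_Integration.integral_mult_right_zero projection_variance_def)
  finally show ?thesis .
qed

end

section \<open>Factorials, exponential constants and normalization\<close>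

lemma power_self_le_fact: "real j ^ j \<le> exp 1 ^ j * fact j"
proof -
  \<comment> \<open>j^j / j! is a single term of the series for e^j.\<close>
  have "(\<Sum>i\<in>{j}. inverse (fact i) * real j ^ i) \<le> (\<Sum>i. inverse (fact i) * real j ^ i)"
    by (intro sum_le_suminf summable_exp) auto
  also have "\<dots> = exp (real j)"
    by (simp add: exp_def field_simps)
  also have "\<dots> = exp 1 ^ j"
    by (simp add: exp_of_nat_mult[symmetric])
  finally show ?thesis
    by (simp add: field_simps)
qed

text \<open>j^j is traded for e^j j! once for the joint cumulants and k times for the number of
  families. The single leftover factor j k is at most 2^(k j), so all the rest is exponential in
  j.\<close>

lemma combinatorial_factor_le:
  assumes "j \<ge> 1" "k \<ge> 1"
  shows "real j ^ (j - 1) * real (j * k) ^ (k * j + 1) \<le> fact j ^ (1 + k) * (exp 1 * (2 * real k * exp 1) ^ k) ^ j"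
proof -
  have "real j ^ (j - 1) \<le> real j ^ j"
    using assms by (intro power_increasing) auto
  then have 1: "real j ^ (j - 1) \<le> exp 1 ^ j * fact j"
    using power_self_le_fact[of j] by linarith
  have "real (j * k) \<le> 2 ^ (k * j)"
    using of_nat_less_two_power[of "j * k", where 'a = real] by (simp add: mult.commute)
  moreover have "real (j * k) ^ (k * j) = (real j ^ j) ^ k * real k ^ (k * j)"
    by (simp add: power_mult_distrib power_mult[symmetric] mult.commute)
  moreover have "(real j ^ j) ^ k \<le> (exp 1 ^ j * fact j) ^ k"
    by (intro power_mono power_self_le_fact) auto
  ultimately have "real (j * k) ^ (k * j + 1) \<le> 2 ^ (k * j) * ((exp 1 ^ j * fact j) ^ k * real k ^ (k * j))"
    unfolding power_add power_one_right
    by (subst mult.commute) (intro mult_mono, auto intro!: mult_right_mono)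
  with 1 have "real j ^ (j - 1) * real (j * k) ^ (k * j + 1)
      \<le> (exp 1 ^ j * fact j) * (2 ^ (k * j) * ((exp 1 ^ j * fact j) ^ k * real k ^ (k * j)))"
    by (intro mult_mono) auto
  also have "\<dots> = fact j ^ (1 + k) * (exp 1 * (2 * real k * exp 1) ^ k) ^ j"
    by (simp add: power_mult_distrib power_mult[symmetric] power_add mult_ac)
  finally show ?thesis .
qed

text \<open>Y and r separate what survives normalization from what cancels: the standard deviation
  removes r^j and leaves Y^(1 - j/2). The dense regime takes Y = n and r = n^(k-1) p^e(G), the
  sparse one Y = n^k p^e(G) and r = 1.\<close>

lemma normalized_bound:
  fixes \<kappa> \<kappa>2 Y r c F L :: real
  assumes pos: "Y > 0" "r > 0" "0 < c" "F \<ge> 0" "L \<ge> 1" and j: "j \<ge> 3"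
    and \<kappa>2: "\<kappa>2 \<ge> c * Y * r\<^sup>2" and \<kappa>: "\<kappa> \<le> F * (L * sqrt c) ^ j * Y * r ^ j"
  shows "\<kappa> / sqrt \<kappa>2 ^ j \<le> F / ((1 / L ^ 6) * Y) powr (real j / 2 - 1)"
proof -
  have s: "sqrt c * sqrt Y * r \<le> sqrt \<kappa>2"
    using real_sqrt_le_mono[OF \<kappa>2] pos by (simp add: real_sqrt_mult)
  have s0: "0 < sqrt c * sqrt Y * r"
    using pos by simp
  have "\<kappa> / sqrt \<kappa>2 ^ j \<le> (F * (L * sqrt c) ^ j * Y * r ^ j) / sqrt \<kappa>2 ^ j"
    using s s0 by (intro divide_right_mono \<kappa> zero_le_power) linarith
  also have "\<dots> \<le> (F * (L * sqrt c) ^ j * Y * r ^ j) / (sqrt c * sqrt Y * r) ^ j"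
    using pos s0 order.strict_trans2[OF s0 s]
    by (intro divide_left_mono power_mono mult_pos_pos[OF zero_less_power zero_less_power] s) auto
  also have "\<dots> = F * L ^ j * (Y / sqrt Y ^ j)"
    using pos by (simp add: power_mult_distrib field_simps)
  also have "Y / sqrt Y ^ j = Y powr (1 - real j / 2)"
  proof -
    have "sqrt Y ^ j = sqrt Y powr real j"
      using pos by (simp add: powr_realpow)
    also have "\<dots> = Y powr (real j / 2)"
      using pos by (simp add: powr_half_sqrt[symmetric] powr_powr)
    finally have "sqrt Y ^ j = Y powr (real j / 2)" .
    then show ?thesis
      using pos by (simp add: powr_diff)
  qed
  \<comment> \<open>j <= 3 j - 6 for j >= 3, and 3 j - 6 = 6 (j/2 - 1): the origin of the sixth
    power in the constant.\<close>
  also have "F * L ^ j * Y powr (1 - real j / 2) \<le> F * L ^ (3 * j - 6) * Y powr (1 - real j / 2)"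
    using pos j by (intro mult_right_mono mult_left_mono power_increasing) auto
  also have "L ^ (3 * j - 6) = (L ^ 6) powr (real j / 2 - 1)"
  proof -
    have "(L ^ 6) powr (real j / 2 - 1) = L powr (6 * (real j / 2 - 1))"
    proof -
      have "L powr 6 = L ^ 6"
        using pos by simp
      then show ?thesis
        using powr_powr[of L 6 "real j / 2 - 1"] by (simp only:)
    qed
    also have "6 * (real j / 2 - 1) = real (3 * j - 6)"
      using j by (simp add: of_nat_diff field_simps)
    finally show ?thesis
      using pos by (simp add: powr_realpow)
  qed
  also have "F * (L ^ 6) powr (real j / 2 - 1) * Y powr (1 - real j / 2)
      = F / ((1 / L ^ 6) * Y) powr (real j / 2 - 1)"
  proof -
    have "Y powr (1 - real j / 2) = 1 / Y powr (real j / 2 - 1)"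
      using pos powr_minus_divide[of Y "real j / 2 - 1"] by simp
    then show ?thesis
      using pos by (simp add: powr_divide powr_mult)
  qed
  finally show ?thesis .
qed

context random_connection_graph
begin

text \<open>L times sqrt c is the exponential base of \<open>combinatorial_factor_le\<close>; c <= 1
  ensures L >= 1.\<close>

lemma normalized_cumulant_le:
  assumes bal: "strongly_balanced {1..k} E" and aut: "num_automorphisms {1..k} E > 0" and j: "j \<ge> 3"
    and pos: "Y > 0" "r > 0" "0 < c" "c \<le> 1"
    and var: "cumulant M 2 copies \<ge> c * Y * r\<^sup>2"
    and B: "\<And>v. k \<le> v \<Longrightarrow> v \<le> j * (k - 1) + 1 \<Longrightarrow>
      real n ^ v * (p powr (real (card E) / (real k - 1))) ^ (v - 1) \<le> Y * r ^ j"
  defines "L \<equiv> exp 1 * (2 * real k * exp 1) ^ k / sqrt c"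
  shows "cumulant M j (normalized M (\<lambda>\<omega>. subgraph_count k E n (R \<omega>)))
    \<le> fact j ^ (1 + k) / ((1 / L ^ 6) * Y) powr (real j / 2 - 1)"
proof -
  define K where "K = exp 1 * (2 * real k * exp 1) ^ k"
  have "1 * 1 \<le> K"
    unfolding K_def
  proof (intro mult_mono one_le_power)
    have "1 * 1 \<le> (2 * real k) * exp 1"
      using k_ge_2 by (intro mult_mono) auto
    then show "1 \<le> 2 * real k * exp 1" by simp
  qed auto
  moreover have sc: "0 < sqrt c" "sqrt c \<le> 1" using pos by auto
  ultimately have "sqrt c \<le> K" by linarith
  moreover have "L = K / sqrt c" by (simp add: L_def K_def)
  ultimately have L: "L \<ge> 1" "L * sqrt c = K"
    using sc(1) by (simp_all add: le_divide_eq)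
  have "cumulant M j copies \<le> real j ^ (j - 1) * real (j * k) ^ (k * j + 1) * (Y * r ^ j)"
    using j by (intro cumulant_copies_le[OF bal _ refl B]) auto
  also have "\<dots> \<le> fact j ^ (1 + k) * (L * sqrt c) ^ j * (Y * r ^ j)"
    unfolding L(2) K_def using pos j k_ge_2 by (intro mult_right_mono combinatorial_factor_le) auto
  finally have "cumulant M j copies \<le> fact j ^ (1 + k) * (L * sqrt c) ^ j * Y * r ^ j"
    by (simp only: mult.assoc)
  from normalized_bound[OF pos(1-3) _ L(1) j var this] show ?thesis
    using cumulant_normalized[OF aut, of j] j by simp
qed

text \<open>Comparing n^(k-1) p^e(G) with 1 thus amounts to comparing n q with 1.\<close>

lemma edge_scale_power:
  "(real n * p powr (real (card E) / (real k - 1))) ^ (k - 1) = real n ^ (k - 1) * p ^ card E"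
proof -
  have "(p powr (real (card E) / (real k - 1))) ^ (k - 1) = p powr (real (card E) / (real k - 1) * real (k - 1))"
    using p_range by (subst powr_powr[symmetric], subst powr_realpow) auto
  also have "\<dots> = p ^ card E"
    using k_ge_2 p_range by (simp add: of_nat_diff powr_realpow)
  finally show ?thesis
    by (simp add: power_mult_distrib)
qed

lemma vertex_term_eq:
  "v \<ge> 1 \<Longrightarrow> real n ^ v * q ^ (v - 1) = real n * (real n * q) ^ (v - 1)"
  by (cases v) (auto simp: power_mult_distrib)

lemma n_power_k: "real n ^ k = real n * real n ^ (k - 1)"
  using k_ge_2 by (cases k) auto

text \<open>At v - 1 = j (k - 1) the vertex term n (n q)^(v-1) equals n r^j with r = n^(k-1) p^e(G).
  The factor 4^k comes from squaring the bound (n/2)^k for the number of embeddings.\<close>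

lemma dense_regime:
  assumes bal: "strongly_balanced {1..k} E" and aut: "num_automorphisms {1..k} E > 0"
    and j: "j \<ge> 3" and n: "n \<ge> 2 * k" and dense: "real n ^ (k - 1) * p ^ card E \<ge> 1"
    and c: "0 < c" "c \<le> 1" "c \<le> projection_variance / 4 ^ k"
  defines "L \<equiv> exp 1 * (2 * real k * exp 1) ^ k / sqrt c"
  shows "cumulant M j (normalized M (\<lambda>\<omega>. subgraph_count k E n (R \<omega>)))
    \<le> fact j ^ (1 + k) / ((1 / L ^ 6) * real n) powr (real j / 2 - 1)"
  unfolding L_def
proof (rule normalized_cumulant_le[OF bal aut j])
  let ?r = "real n ^ (k - 1) * p ^ card E"
  let ?x = "real n * p powr (real (card E) / (real k - 1))"
  show "0 < real n" "0 < ?r"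
    using n_pos p_range by auto
  have pv: "projection_variance > 0"
    using c by (simp add: field_simps) (metis less_le_trans mult_pos_pos zero_less_numeral zero_less_power)
  have "c * real n * ?r\<^sup>2 \<le> projection_variance / 4 ^ k * real n * ?r\<^sup>2"
    using c by (intro mult_right_mono) auto
  also have "\<dots> = ((real n / 2) ^ k * p ^ card E)\<^sup>2 * projection_variance / real n"
  proof -
    have "(real n / 2) ^ k * p ^ card E = real n * ?r / 2 ^ k"
      by (simp add: power_divide n_power_k)
    moreover have "projection_variance / 4 ^ k * x * r\<^sup>2 = (x * r / 2 ^ k)\<^sup>2 * projection_variance / x" if "x > 0" for x r :: real
      using that power_mult_distrib[of "2 :: real" 2 k] by (simp add: power2_eq_square field_simps)
    ultimately show ?thesis
      using n_pos by simp
  qed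
  also have "\<dots> \<le> (real (card (embeddings k n)) * p ^ card E)\<^sup>2 * projection_variance / real n"
    using card_embeddings_ge[OF n] p_range pv
    by (intro divide_right_mono mult_right_mono power_mono) auto
  also have "\<dots> \<le> cumulant M 2 copies"
    by (rule cumulant_2_ge_projection[OF pv])
  finally show "c * real n * ?r\<^sup>2 \<le> cumulant M 2 copies" .
  have x: "1 \<le> ?x"
  proof (rule ccontr)
    assume "\<not> 1 \<le> ?x"
    then have "?x ^ (k - 1) < 1 ^ (k - 1)"
      using k_ge_2 by (intro power_strict_mono) auto
    then show False
      using dense unfolding edge_scale_power power_one by linarith
  qed
  fix v assume v: "k \<le> v" "v \<le> j * (k - 1) + 1"
  have "real n ^ v * (p powr (real (card E) / (real k - 1))) ^ (v - 1) = real n * ?x ^ (v - 1)"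
    using v k_ge_2 by (intro vertex_term_eq) auto
  also have "\<dots> \<le> real n * ?x ^ ((k - 1) * j)"
    using x v by (intro mult_left_mono power_increasing) (auto simp: mult.commute)
  also have "\<dots> = real n * ?r ^ j"
    by (simp only: power_mult edge_scale_power)
  finally show "real n ^ v * (p powr (real (card E) / (real k - 1))) ^ (v - 1) \<le> real n * ?r ^ j" .
qed (use c in auto)

text \<open>At v = k the vertex term is n^k p^e(G), so r = 1 is the right scale. The second
  smallness condition makes the loss in the diagonal variance bound at most half of the main term;
  with the bound (n/2)^k for the number of embeddings this produces 2^(k+1).\<close>

lemma sparse_regime:
  assumes bal: "strongly_balanced {1..k} E" and aut: "num_automorphisms {1..k} E > 0"
    and j: "j \<ge> 3" and n: "n \<ge> 2 * k"
    and sparse: "real n ^ (k - 1) * p ^ card E \<le> 1"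
      "(real k)\<^sup>2 * (real n ^ (k - 1) * p ^ card E) \<le> graph_density / 2"
    and c: "0 < c" "c \<le> 1" "c \<le> graph_density / 2 ^ (k + 1)"
  defines "L \<equiv> exp 1 * (2 * real k * exp 1) ^ k / sqrt c"
  shows "cumulant M j (normalized M (\<lambda>\<omega>. subgraph_count k E n (R \<omega>)))
    \<le> fact j ^ (1 + k) / ((1 / L ^ 6) * (real n ^ k * p ^ card E)) powr (real j / 2 - 1)"
  unfolding L_def
proof (rule normalized_cumulant_le[OF bal aut j, where r = 1])
  let ?Y = "real n ^ k * p ^ card E"
  let ?x = "real n * p powr (real (card E) / (real k - 1))"
  show "0 < ?Y"
    using n_pos p_range by auto
  have d: "graph_density \<ge> 0" by (rule graph_density_range)
  have "c * ?Y * 1\<^sup>2 = c * ?Y"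
    by simp
  also have "\<dots> \<le> graph_density / 2 ^ (k + 1) * ?Y"
    using p_range by (intro mult_right_mono c) auto
  also have "\<dots> = (real n / 2) ^ k * (p ^ card E * (graph_density / 2))"
    by (simp add: power_divide mult_ac)
  also have "\<dots> \<le> real (card (embeddings k n)) * (p ^ card E * (graph_density / 2))"
    using card_embeddings_ge[OF n] p_range d by (intro mult_right_mono) auto
  also have "\<dots> \<le> real (card (embeddings k n)) *
      (p ^ card E * graph_density - (real k)\<^sup>2 * real n ^ (k - 1) * (p ^ card E)\<^sup>2)"
  proof (intro mult_left_mono)
    have "p ^ card E * ((real k)\<^sup>2 * (real n ^ (k - 1) * p ^ card E)) \<le> p ^ card E * (graph_density / 2)"
      using sparse(2) p_range by (intro mult_left_mono) auto
    then show "p ^ card E * (graph_density / 2) \<le> p ^ card E * graph_density - (real k)\<^sup>2 * real n ^ (k - 1) * (p ^ card E)\<^sup>2"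
      by (simp add: power2_eq_square algebra_simps)
  qed simp
  also have "\<dots> \<le> cumulant M 2 copies"
    by (rule cumulant_2_ge_diagonal)
  finally show "c * ?Y * 1\<^sup>2 \<le> cumulant M 2 copies" .
  have x0: "0 \<le> ?x" by simp
  have x: "?x \<le> 1"
  proof (rule ccontr)
    assume "\<not> ?x \<le> 1"
    then have "1 < ?x ^ (k - 1)"
      using k_ge_2 by (intro one_less_power) auto
    then show False
      using sparse(1) unfolding edge_scale_power by linarith
  qed
  fix v assume v: "k \<le> v" "v \<le> j * (k - 1) + 1"
  have "real n ^ v * (p powr (real (card E) / (real k - 1))) ^ (v - 1) = real n * ?x ^ (v - 1)"
    using v k_ge_2 by (intro vertex_term_eq) auto
  also have "\<dots> \<le> real n * ?x ^ (k - 1)"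
    using x x0 v by (intro mult_left_mono power_decreasing) auto
  also have "\<dots> = ?Y * 1 ^ j"
    by (simp only: edge_scale_power n_power_k) simp
  finally show "real n ^ v * (p powr (real (card E) / (real k - 1))) ^ (v - 1) \<le> ?Y * 1 ^ j" .
qed (use c in auto)

end

section \<open>Choice of the constant and passage to large n\<close>

lemma connected_edges_nonempty:
  fixes E :: "nat set set"
  assumes "k \<ge> 2" "graph_connected {1..k} E"
  shows "E \<noteq> {}"
proof
  assume E: "E = {}"
  have "(1 :: nat, 2) \<in> {(x, y). {x, y} \<in> E}\<^sup>*"
    using assms by (auto simp: graph_connected_def)
  then show False
    unfolding E by simp
qed

theorem corollary7p8:
  fixes M :: "nat \<Rightarrow> 'w measure"
    and \<mu> :: "(real ^ 'd) measure"
    and H :: "real ^ 'd \<Rightarrow> real ^ 'd \<Rightarrow> real"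
    and p :: "nat \<Rightarrow> real"
    and X :: "nat \<Rightarrow> nat \<Rightarrow> 'w \<Rightarrow> real ^ 'd"
    and R :: "nat \<Rightarrow> 'w \<Rightarrow> nat set set"
    and k :: nat
    and E :: "nat set set"
  assumes mu_prob: "prob_space \<mu>"
    and mu_borel: "sets \<mu> = sets borel"
    and mu_atomless: "\<And>x. measure \<mu> {x} = 0"
    and H_measurable: "(\<lambda>(x, y). H x y) \<in> borel_measurable (borel \<Otimes>\<^sub>M borel)"
    and H_symmetric: "\<And>x y. H x y = H y x"
    and H_range: "\<And>x y. 0 \<le> H x y \<and> H x y \<le> 1"
    and p_range: "\<And>n. n \<ge> 1 \<Longrightarrow> 0 < p n \<and> p n < 1"
    and model: "\<And>n. n \<ge> 1 \<Longrightarrow> binomial_random_connection (M n) \<mu> H (p n) n (X n) (R n)"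
    and k_ge_2: "k \<ge> 2"
    and graph: "simple_graph {1..k} E"
    and conn: "graph_connected {1..k} E"
    and balanced: "strongly_balanced {1..k} E"
    and variance_pos: "\<And>n. n \<ge> 1 \<Longrightarrow>
      prob_space.variance (M n)
        (\<lambda>\<omega>. \<Sum>l = 1..k. vertex_projection k E \<mu> H (p n) l (X n 1 \<omega>)) > 0"
  shows "\<exists>C>0.
    (much_less (\<lambda>n. real n powr (- (real k - 1) / real (card E))) p \<longrightarrow>
      (\<forall>\<^sub>F n in sequentially. \<forall>j\<ge>3.
        cumulant (M n) j (normalized (M n) (\<lambda>\<omega>. subgraph_count k E n (R n \<omega>)))
          \<le> fact j ^ (1 + k) / (C * real n) powr (real j / 2 - 1))) \<and>
    (much_less p (\<lambda>n. real n powr (- (real k - 1) / real (card E))) \<longrightarrow>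
      (\<forall>\<^sub>F n in sequentially. \<forall>j\<ge>3.
        cumulant (M n) j (normalized (M n) (\<lambda>\<omega>. subgraph_count k E n (R n \<omega>)))
          \<le> fact j ^ (1 + k) / (C * (real n ^ k * p n ^ card E)) powr (real j / 2 - 1)))"
proof -
  interpret G: connection_graph \<mu> H k E
    using mu_prob mu_borel H_measurable H_symmetric H_range graph
    by (intro connection_graph.intro connection_kernel.intro connection_kernel_axioms.intro
        connection_graph_axioms.intro) auto
  have RC: "random_connection_graph \<mu> H k E (M n) (p n) n (X n) (R n)" if "n \<ge> 1" for n
    using that p_range[OF that] model[OF that] k_ge_2
    by (intro random_connection_graph.intro random_connection_graph_axioms.intro
        G.connection_graph_axioms) auto
  have "(p 1 ^ card E / real (num_automorphisms {1..k} E))\<^sup>2 * G.projection_variance > 0"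
    using variance_pos[of 1] random_connection_graph.variance_vertex_projection[OF RC[of 1]] by simp
  \<comment> \<open>Division by zero yields 0, so positivity of the product also excludes a
    vanishing automorphism count.\<close>
  then have aut: "num_automorphisms {1..k} E > 0" and pv: "G.projection_variance > 0"
    by (auto simp: zero_less_mult_iff)
  have dens: "G.graph_density > 0"
  proof (rule ccontr)
    assume "\<not> G.graph_density > 0"
    then have "G.graph_density = 0"
      using G.graph_density_range(1) by linarith
    then show False
      using G.projection_variance_le pv by simp
  qed
  \<comment> \<open>Connectedness on at least two vertices supplies an edge; the threshold exponent
    has e(G) in its denominator.\<close>
  have E_pos: "card E > 0"
    using connected_edges_nonempty[OF k_ge_2 conn] finite_edges[OF graph] by (simp add: card_gt_0_iff)
  \<comment> \<open>The minimum meets the constraints of both regimes, so that one C serves for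
    both.\<close>
  define c where "c = Min {1, G.projection_variance / 4 ^ k, G.graph_density / 2 ^ (k + 1)}"
  have c: "0 < c" "c \<le> 1" "c \<le> G.projection_variance / 4 ^ k" "c \<le> G.graph_density / 2 ^ (k + 1)"
    using pv dens by (auto simp: c_def)
  define C where "C = 1 / (exp 1 * (2 * real k * exp 1) ^ k / sqrt c) ^ 6"
  have C: "C > 0"
    using c k_ge_2 by (simp add: C_def)
  \<comment> \<open>Raising the threshold to the power e(G) turns a comparison with p into a
    comparison of n^(k-1) p^e(G) with 1.\<close>
  have scale: "(real n powr (- (real k - 1) / real (card E))) ^ card E = 1 / real n ^ (k - 1)" if "n \<ge> 1" for n
  proof -
    have "(real n powr (- (real k - 1) / real (card E))) ^ card E
        = real n powr (- (real k - 1) / real (card E) * real (card E))"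
      using that by (subst powr_powr[symmetric], subst powr_realpow) auto
    also have "- (real k - 1) / real (card E) * real (card E) = - real (k - 1)"
      using E_pos k_ge_2 by (simp add: of_nat_diff)
    also have "real n powr - real (k - 1) = 1 / real n ^ (k - 1)"
      using that by (simp add: powr_minus powr_realpow divide_inverse)
    finally show ?thesis .
  qed
  have large: "\<forall>\<^sub>F n in sequentially. n \<ge> 1 \<and> n \<ge> 2 * k"
    using eventually_ge_at_top[of 1] eventually_ge_at_top[of "2 * k"] by eventually_elim simp
  show ?thesis
  proof (intro exI[of _ C] conjI C impI)
    assume "much_less (\<lambda>n. real n powr (- (real k - 1) / real (card E))) p"
    then have "(\<lambda>n. real n powr (- (real k - 1) / real (card E)) / p n) \<longlonglongrightarrow> 0"
      by (simp add: much_less_def)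
    then have "\<forall>\<^sub>F n in sequentially. real n powr (- (real k - 1) / real (card E)) / p n < 1"
      by (rule order_tendstoD(2)) simp
    with large show "\<forall>\<^sub>F n in sequentially. \<forall>j\<ge>3.
        cumulant (M n) j (normalized (M n) (\<lambda>\<omega>. subgraph_count k E n (R n \<omega>)))
          \<le> fact j ^ (1 + k) / (C * real n) powr (real j / 2 - 1)"
    proof eventually_elim
      case (elim n)
      then have n: "n \<ge> 1" "n \<ge> 2 * k" and p: "p n > 0"
        using p_range by auto
      have "(real n powr (- (real k - 1) / real (card E))) ^ card E \<le> p n ^ card E"
        using elim p by (intro power_mono) (auto simp: field_simps)
      then have "real n ^ (k - 1) * p n ^ card E \<ge> 1"
        unfolding scale[OF n(1)] using n by (simp add: field_simps)
      then show ?case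
        unfolding C_def using random_connection_graph.dense_regime[OF RC[OF n(1)] balanced aut _ n(2) _ c(1,2,3)] by blast
    qed
  next
    assume "much_less p (\<lambda>n. real n powr (- (real k - 1) / real (card E)))"
    then have "(\<lambda>n. (p n / real n powr (- (real k - 1) / real (card E))) ^ card E) \<longlonglongrightarrow> 0 ^ card E"
      unfolding much_less_def by (intro tendsto_power) auto
    moreover have "\<forall>\<^sub>F n in sequentially. (p n / real n powr (- (real k - 1) / real (card E))) ^ card E
        = real n ^ (k - 1) * p n ^ card E"
      using large
    proof eventually_elim
      case (elim n)
      then have "n \<ge> 1" by simp
      then show ?case
        unfolding power_divide scale[OF \<open>n \<ge> 1\<close>] by simp
    qed
    ultimately have lim: "(\<lambda>n. real n ^ (k - 1) * p n ^ card E) \<longlonglongrightarrow> 0"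
      using tendsto_cong zero_power[OF E_pos, where 'a = real] by force
    \<comment> \<open>The two entries encode the two smallness conditions of
      \<open>sparse_regime\<close>.\<close>
    define \<epsilon> where "\<epsilon> = min 1 (G.graph_density / (2 * (real k)\<^sup>2))"
    have "\<epsilon> > 0"
      using dens k_ge_2 by (simp add: \<epsilon>_def)
    then have "\<forall>\<^sub>F n in sequentially. real n ^ (k - 1) * p n ^ card E < \<epsilon>"
      by (rule order_tendstoD(2)[OF lim])
    with large show "\<forall>\<^sub>F n in sequentially. \<forall>j\<ge>3.
        cumulant (M n) j (normalized (M n) (\<lambda>\<omega>. subgraph_count k E n (R n \<omega>)))
          \<le> fact j ^ (1 + k) / (C * (real n ^ k * p n ^ card E)) powr (real j / 2 - 1)"
    proof eventually_elim
      case (elim n)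
      then have n: "n \<ge> 1" "n \<ge> 2 * k" by auto
      have "real n ^ (k - 1) * p n ^ card E \<le> 1"
        using elim by (simp add: \<epsilon>_def)
      moreover have "(real k)\<^sup>2 * (real n ^ (k - 1) * p n ^ card E) \<le> G.graph_density / 2"
        using elim k_ge_2 by (simp add: \<epsilon>_def field_simps)
      ultimately show ?case
        unfolding C_def using random_connection_graph.sparse_regime[OF RC[OF n(1)] balanced aut _ n(2) _ _ c(1,2,4)] by blast
    qed
  qed
qed

end
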